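(* Let $V$ be a nonempty open subset of $\ell^2$. Then there exists an exhaustion function $\eta$ on $V$ with $\eta\in C^\infty_{F^\infty}(V)$.
   Context: $\ell^2$ is the complex Hilbert space of square-summable complex sequences $\mathbf z=(z_j)_{j\ge1}$, $z_j=x_j+\sqrt{-1}\,y_j$ with $x_j,y_j\in\mathbb R$, with its canonical norm $\|\cdot\|$. Uniform inclusion: for a nonempty bounded $S\subset V$ put $d(S,\partial V)=\inf\{\|\mathbf z_1-\mathbf z_2\|:\mathbf z_1\in S,\mathbf z_2\in\partial V\}$ if $V\ne\ell^2$ and $d(S,\partial V)=+\infty$ if $V=\ell^2$. $S$ is uniformly included in $V$, written $S\stackrel{\circ}{\subset}V$, if $S$ is bounded and $d(S,\partial V)>0$; the empty set is also counted as uniformly included. Exhaustion function on $V$: a real-valued function $\eta$ on $V$ such that $\{\mathbf z\in V:\eta(\mathbf z)\le t\}\stackrel{\circ}{\subset}V$ for every $t\in\mathbb R$. Function spaces: partial derivatives $\partial/\partial x_j$ and $\partial/\partial y_j$ are the usual limits of difference quotients in the $j$-th coordinate along real increments $\tau$ and imaginary increments $\sqrt{-1}\,\tau$ ($\tau\in\mathbb R$). $C^k(V)$ is the set of $f:V\to\mathbb C$ such that $f$ and all its partial derivatives (in the variables $x_j,y_j$, $j\ge1$) of order up to $k$ exist and are continuous on $V$; $C^\infty(V)=\bigcap_kC^k(V)$. Put $\partial_j=\frac12(\frac{\partial}{\partial x_j}-\sqrt{-1}\frac{\partial}{\partial y_j})$, $\overline\partial_j=\frac12(\frac{\partial}{\partial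 x_j}+\sqrt{-1}\frac{\partial}{\partial y_j})$ and, for finitely supported sequences $\alpha,\beta$ of nonnegative integers, $\partial_\alpha=\prod_j\partial_j^{\alpha_j}$, $\overline\partial_\beta=\prod_j\overline\partial_j^{\beta_j}$. $C^1_F(V)$ is the set of $f\in C^1(V)$ with $\sup_S\{|f|+\sum_{j\ge1}(|\partial_jf|^2+|\overline\partial_jf|^2)\}<\infty$ for every $S\stackrel{\circ}{\subset}V$. $C^\infty_{F^\infty}(V)$ is the set of $f\in C^\infty(V)$ such that $\partial_\alpha\overline\partial_\beta f\in C^1_F(V)$ for all finitely supported multi-indices $\alpha,\beta$. *)

theory Defs
  imports "HOL-Analysis.Analysis"
begin

section \<open>The Hilbert space of square-summable complex sequences\<close>

text \<open>Coordinates are indexed from 0: \<open>coord z j\<close> is \<open>z\<^sub>j\<^sub>+\<^sub>1\<close> of the usual numbering from 1.\<close>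

typedef ell2 = "{z :: nat \<Rightarrow> complex. summable (\<lambda>j. (cmod (z j))\<^sup>2)}"
  morphisms coord Abs_ell2
  by (rule exI[of _ "\<lambda>_. 0"]) simp

setup_lifting type_definition_ell2

lemma summable_coord: "summable (\<lambda>j. (cmod (coord z j))\<^sup>2)"
  using coord[of z] by simp

lemma ell2_eqI: "(\<And>j. coord z j = coord w j) \<Longrightarrow> z = w"
  by (simp add: coord_inject[symmetric] fun_eq_iff)

lemma cmod_add_sq_le: "(cmod (a + b))\<^sup>2 \<le> 2 * (cmod a)\<^sup>2 + 2 * (cmod b)\<^sup>2"
proof -
  have "(cmod (a + b))\<^sup>2 \<le> (cmod a + cmod b)\<^sup>2"
    by (simp add: norm_triangle_ineq power_mono)
  also have "\<dots> \<le> 2 * (cmod a)\<^sup>2 + 2 * (cmod b)\<^sup>2"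
    using sum_squares_ge_zero[of "cmod a - cmod b" 0]
    by (simp add: power2_eq_square algebra_simps)
  finally show ?thesis .
qed

lemma summable_cmod_add:
  assumes "summable (\<lambda>j::nat. (cmod (z j))\<^sup>2)" "summable (\<lambda>j. (cmod (w j))\<^sup>2)"
  shows "summable (\<lambda>j. (cmod (z j + w j))\<^sup>2)"
proof (rule summable_comparison_test')
  show "summable (\<lambda>j. 2 * (cmod (z j))\<^sup>2 + 2 * (cmod (w j))\<^sup>2)"
    using assms by (intro summable_add summable_mult)
  show "norm ((cmod (z j + w j))\<^sup>2) \<le> 2 * (cmod (z j))\<^sup>2 + 2 * (cmod (w j))\<^sup>2" for j
    using cmod_add_sq_le[of "z j" "w j"] by simp
qed

instantiation ell2 :: real_vector
begin

lift_definition zero_ell2 :: ell2 is "\<lambda>_. 0" by simp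

lift_definition plus_ell2 :: "ell2 \<Rightarrow> ell2 \<Rightarrow> ell2" is "\<lambda>z w j. z j + w j"
  by (rule summable_cmod_add)

lift_definition uminus_ell2 :: "ell2 \<Rightarrow> ell2" is "\<lambda>z j. - z j" by simp

lift_definition minus_ell2 :: "ell2 \<Rightarrow> ell2 \<Rightarrow> ell2" is "\<lambda>z w j. z j - w j"
proof -
  fix z w :: "nat \<Rightarrow> complex"
  assume "summable (\<lambda>j. (cmod (z j))\<^sup>2)" "summable (\<lambda>j. (cmod (w j))\<^sup>2)"
  then show "summable (\<lambda>j. (cmod (z j - w j))\<^sup>2)"
    using summable_cmod_add[of z "\<lambda>j. - w j"] by simp
qed

lift_definition scaleR_ell2 :: "real \<Rightarrow> ell2 \<Rightarrow> ell2" is "\<lambda>r z j. r *\<^sub>R z j"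
  by (simp add: power_mult_distrib summable_mult)

instance
  by standard (transfer; simp add: fun_eq_iff algebra_simps)+

end

lemma summable_inner_coord: "summable (\<lambda>j. inner (coord z j) (coord w j))"
proof (rule summable_comparison_test')
  show "summable (\<lambda>j. (cmod (coord z j))\<^sup>2 + (cmod (coord w j))\<^sup>2)"
    by (intro summable_add summable_coord)
  fix j
  have "\<bar>inner (coord z j) (coord w j)\<bar> \<le> cmod (coord z j) * cmod (coord w j)"
    by (rule Cauchy_Schwarz_ineq2)
  also have "\<dots> \<le> (cmod (coord z j))\<^sup>2 + (cmod (coord w j))\<^sup>2"
    using sum_squares_bound[of "cmod (coord z j)" "cmod (coord w j)"]
      mult_nonneg_nonneg[OF norm_ge_zero[of "coord z j"] norm_ge_zero[of "coord w j"]]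
    by linarith
  finally show "norm (inner (coord z j) (coord w j)) \<le> (cmod (coord z j))\<^sup>2 + (cmod (coord w j))\<^sup>2"
    by simp
qed

instantiation ell2 :: real_inner
begin

text \<open>The real inner product underlying the Hermitian one, i.e. \<open>Re (\<Sum>j. z j * cnj (w j))\<close>.\<close>

definition inner_ell2 :: "ell2 \<Rightarrow> ell2 \<Rightarrow> real"
  where "inner_ell2 z w = (\<Sum>j. inner (coord z j) (coord w j))"

definition norm_ell2 :: "ell2 \<Rightarrow> real"
  where "norm_ell2 z = sqrt (\<Sum>j. (cmod (coord z j))\<^sup>2)"

definition dist_ell2 :: "ell2 \<Rightarrow> ell2 \<Rightarrow> real"
  where "dist_ell2 z w = norm (z - w)"

definition sgn_ell2 :: "ell2 \<Rightarrow> ell2"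
  where "sgn_ell2 z = z /\<^sub>R norm z"

definition uniformity_ell2 :: "(ell2 \<times> ell2) filter"
  where "uniformity_ell2 = (INF e\<in>{0<..}. principal {(z, w). dist z w < e})"

definition open_ell2 :: "ell2 set \<Rightarrow> bool"
  where "open_ell2 U = (\<forall>z\<in>U. \<forall>\<^sub>F (z', w) in uniformity. z' = z \<longrightarrow> w \<in> U)"

instance
proof
  fix z w u :: ell2 and r :: real and U :: "ell2 set"
  show "dist z w = norm (z - w)" by (fact dist_ell2_def)
  show "sgn z = z /\<^sub>R norm z" by (fact sgn_ell2_def)
  show "uniformity = (INF e\<in>{0<..}. principal {(z, w :: ell2). dist z w < e})"
    by (fact uniformity_ell2_def)
  show "open U = (\<forall>z\<in>U. \<forall>\<^sub>F (z', w) in uniformity. z' = z \<longrightarrow> w \<in> U)"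
    by (fact open_ell2_def)
  show "inner z w = inner w z"
    by (simp add: inner_ell2_def inner_commute)
  show "inner (z + w) u = inner z u + inner w u"
    by (simp add: inner_ell2_def plus_ell2.rep_eq inner_add_left suminf_add summable_inner_coord)
  show "inner (r *\<^sub>R z) w = r * inner z w"
    by (simp add: inner_ell2_def scaleR_ell2.rep_eq suminf_mult summable_inner_coord
        del: scaleR_conv_of_real)
  show "0 \<le> inner z z"
    unfolding inner_ell2_def by (intro suminf_nonneg summable_inner_coord) simp
  show "(inner z z = 0) = (z = 0)"
  proof
    assume "inner z z = 0"
    then have "\<forall>j. inner (coord z j) (coord z j) = 0"
      unfolding inner_ell2_def by (subst (asm) suminf_eq_zero_iff) (auto intro: summable_inner_coord)
    then show "z = 0"
      by (intro ell2_eqI) (simp add: zero_ell2.rep_eq)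
  qed (simp add: inner_ell2_def zero_ell2.rep_eq)
  show "norm z = sqrt (inner z z)"
    by (simp add: norm_ell2_def inner_ell2_def dot_square_norm)
qed

end

lift_definition single :: "nat \<Rightarrow> complex \<Rightarrow> ell2" is "\<lambda>j c i. if i = j then c else 0"
  by (rule summable_finite[of "{j}" for j]) auto


section \<open>Uniform inclusion and exhaustion functions\<close>

text \<open>The value \<^const>\<open>setdist\<close> is the intended infimum only for nonempty sets. The frontier of a
  nonempty proper subset is nonempty because the space is connected; the cases \<open>S = {}\<close> and
  \<open>V = UNIV\<close> are treated separately.\<close>

definition bdry_dist :: "ell2 set \<Rightarrow> ell2 set \<Rightarrow> ereal"
  where "bdry_dist S V = (if V = UNIV then \<infinity> else ereal (setdist S (frontier V)))"

definition uniformly_included :: "ell2 set \<Rightarrow> ell2 set \<Rightarrow> bool"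
  where "uniformly_included S V \<longleftrightarrow> S = {} \<or> (S \<subseteq> V \<and> bounded S \<and> bdry_dist S V > 0)"

definition exhaustion_function :: "ell2 set \<Rightarrow> (ell2 \<Rightarrow> real) \<Rightarrow> bool"
  where "exhaustion_function V \<eta> \<longleftrightarrow> (\<forall>t. uniformly_included {z \<in> V. \<eta> z \<le> t} V)"


section \<open>Function spaces\<close>

text \<open>Functions on an open set \<open>V\<close> are represented by total functions whose values outside \<open>V\<close> are
  irrelevant. Membership in the spaces below depends on the values on \<open>V\<close> only, because \<open>V\<close> is
  open.\<close>

datatype real_var = X_var nat | Y_var nat

primrec direction :: "real_var \<Rightarrow> ell2" where
  "direction (X_var j) = single j 1"
| "direction (Y_var j) = single j \<i>"

definition has_partial :: "real_var \<Rightarrow> (ell2 \<Rightarrow> complex) \<Rightarrow> ell2 \<Rightarrow> bool"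
  where "has_partial v f z \<longleftrightarrow> (\<lambda>\<tau>::real. f (z + \<tau> *\<^sub>R direction v)) differentiable (at 0)"

definition partial :: "real_var \<Rightarrow> (ell2 \<Rightarrow> complex) \<Rightarrow> ell2 \<Rightarrow> complex"
  where "partial v f z = vector_derivative (\<lambda>\<tau>::real. f (z + \<tau> *\<^sub>R direction v)) (at 0)"

text \<open>Mixed partial derivatives are indexed by lists, so every sequence of differentiations counts
  separately; the last entry of the list is the variable of the first differentiation.\<close>

definition iter_partial :: "real_var list \<Rightarrow> (ell2 \<Rightarrow> complex) \<Rightarrow> ell2 \<Rightarrow> complex"
  where "iter_partial vs = foldr partial vs"

definition C_k :: "nat \<Rightarrow> ell2 set \<Rightarrow> (ell2 \<Rightarrow> complex) set"
  where "C_k k V = {f.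
    (\<forall>vs v. length vs < k \<longrightarrow> (\<forall>z\<in>V. has_partial v (iter_partial vs f) z)) \<and>
    (\<forall>vs. length vs \<le> k \<longrightarrow> continuous_on V (iter_partial vs f))}"

definition C_infinity :: "ell2 set \<Rightarrow> (ell2 \<Rightarrow> complex) set"
  where "C_infinity V = (\<Inter>k. C_k k V)"

definition d_op :: "nat \<Rightarrow> (ell2 \<Rightarrow> complex) \<Rightarrow> ell2 \<Rightarrow> complex"
  where "d_op j f z = (partial (X_var j) f z - \<i> * partial (Y_var j) f z) / 2"

definition dbar_op :: "nat \<Rightarrow> (ell2 \<Rightarrow> complex) \<Rightarrow> ell2 \<Rightarrow> complex"
  where "dbar_op j f z = (partial (X_var j) f z + \<i> * partial (Y_var j) f z) / 2"

text \<open>Product of the operators \<open>D j ^ \<alpha> j\<close>. A product of operators needs an order; the indices are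
  taken in increasing order, with the largest applied first. On \<^const>\<open>C_infinity\<close> the operators
  commute.\<close>

definition multi_op ::
    "(nat \<Rightarrow> (ell2 \<Rightarrow> complex) \<Rightarrow> ell2 \<Rightarrow> complex) \<Rightarrow> (nat \<Rightarrow> nat) \<Rightarrow> (ell2 \<Rightarrow> complex) \<Rightarrow> ell2 \<Rightarrow> complex"
  where "multi_op D \<alpha> = foldr (\<lambda>j. D j ^^ \<alpha> j) (sorted_list_of_set {j. \<alpha> j \<noteq> 0})"

text \<open>The supremum is taken in the extended nonnegative reals, so that its finiteness includes the
  convergence of the series at every point.\<close>

definition C1_F :: "ell2 set \<Rightarrow> (ell2 \<Rightarrow> complex) set"
  where "C1_F V = {f \<in> C_k 1 V. \<forall>S. uniformly_included S V \<longrightarrow>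
    (SUP z\<in>S. ennreal (cmod (f z)) +
      (\<Sum>j. ennreal ((cmod (d_op j f z))\<^sup>2 + (cmod (dbar_op j f z))\<^sup>2))) < \<infinity>}"

definition C_infinity_F :: "ell2 set \<Rightarrow> (ell2 \<Rightarrow> complex) set"
  where "C_infinity_F V = {f \<in> C_infinity V.
    \<forall>\<alpha> \<beta>. finite {j. \<alpha> j \<noteq> 0} \<longrightarrow> finite {j. \<beta> j \<noteq> 0} \<longrightarrow>
      multi_op d_op \<alpha> (multi_op dbar_op \<beta> f) \<in> C1_F V}"

end

theory Submission
  imports Defs
begin

text \<open>
  The Lipschitz cut-offs \<open>f\<^sub>n\<close>, which vanish where \<open>norm z \<le> n\<close> and
  \<open>n * \<rho> z \<ge> 2\<close> for the boundary distance \<open>\<rho>\<close>, are smoothed and added up.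
  Smoothing is an infinite composition of one-dimensional box averages, in which every real
  coordinate direction recurs infinitely often and the radii are summable, so that it converges
  uniformly on Lipschitz functions. The derivative of a box average along its own direction is a
  difference quotient. A partial derivative of the smoothed function is therefore obtained by
  replacing one average by a difference quotient, which again gives a bounded Lipschitz function.
  A Lipschitz function with continuous partial derivatives has its gradient bounded in \<open>\<ell>\<^sup>2\<close> by
  the Lipschitz constant, and this applies to all mixed partial derivatives. On a uniformly included
  set only finitely many of the smoothed cut-offs are nonzero.
\<close>

section \<open>Smoothing by iterated box averages\<close>

definition average :: "real \<Rightarrow> (real \<Rightarrow> real) \<Rightarrow> real"
  where "average r g = integral {-r..r} g / (2 * r)"

lemma average_close:
  assumes r: "0 < r" and g: "continuous_on {-r..r} g"
    and B: "\<And>t. t \<in> {-r..r} \<Longrightarrow> \<bar>g t - c\<bar> \<le> B"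
  shows "\<bar>average r g - c\<bar> \<le> B"
proof -
  have "integral {-r..r} (\<lambda>t. g t - c) = integral {-r..r} g - 2 * r * c"
    using r by (subst integral_diff) (auto intro!: integrable_continuous_interval g)
  then have "average r g - c = integral {-r..r} (\<lambda>t. g t - c) / (2 * r)"
    using r by (simp add: average_def field_simps)
  moreover have "norm (integral {-r..r} (\<lambda>t. g t - c)) \<le> B * (r - - r)"
    using r B by (intro integral_bound) (auto intro!: continuous_intros g)
  ultimately show ?thesis
    using r by (simp add: pos_divide_le_eq mult.commute)
qed

lemma average_diff:
  assumes "continuous_on {-r..r} g" "continuous_on {-r..r} h"
  shows "average r g - average r h = average r (\<lambda>t. g t - h t)"
  using assms
  by (simp add: average_def integral_diff integrable_continuous_interval diff_divide_distrib)

lemma average_nonneg: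
  assumes "0 < r" "continuous_on {-r..r} g" "\<And>t. 0 \<le> g t"
  shows "0 \<le> average r g"
  unfolding average_def using assms
  by (intro divide_nonneg_nonneg integral_nonneg integrable_continuous_interval) auto

text \<open>Averaging and then differentiating along the same line needs no differentiability of
  \<open>h\<close>: by the fundamental theorem of calculus the average is a difference of two values
  of an antiderivative.\<close>

lemma average_shift_derivative:
  fixes h :: "real \<Rightarrow> real"
  assumes r: "0 < r" and h: "continuous_on UNIV h"
  shows "((\<lambda>\<tau>. average r (\<lambda>t. h (\<tau> + t))) has_real_derivative (h r - h (- r)) / (2 * r)) (at 0)"
proof -
  \<comment> \<open>For \<bar>\<tau>\<bar> < r and \<bar>t\<bar> \<le> r the point \<tau> + t stays
    inside the open interval (-R, R), where the antiderivative has a two-sided derivative.\<close>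
  define R where "R = 2 * r + 1"
  obtain H where H: "\<And>x. x \<in> {-R..R} \<Longrightarrow> (H has_vector_derivative h x) (at x within {-R..R})"
    using antiderivative_continuous continuous_on_subset[OF h subset_UNIV] by blast
  have H': "(H has_real_derivative h x) (at x)" if "x \<in> {-R<..<R}" for x
  proof -
    have "x \<in> {-R..R}" using that by simp
    moreover have "at x within {-R..R} = at x"
      by (rule at_within_Icc_at) (use that in auto)
    ultimately show ?thesis
      using H[of x] by (simp add: has_real_derivative_iff_has_vector_derivative)
  qed
  have eq: "average r (\<lambda>t. h (\<tau> + t)) = (H (\<tau> + r) - H (\<tau> - r)) / (2 * r)" if "\<bar>\<tau>\<bar> < r" for \<tau>
  proof -
    have "((\<lambda>t. h (\<tau> + t)) has_integral (H (\<tau> + r) - H (\<tau> + - r))) {-r..r}"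
    proof (rule fundamental_theorem_of_calculus)
      fix x assume x: "x \<in> {-r..r}"
      have "((\<lambda>t. H (\<tau> + t)) has_real_derivative h (\<tau> + x) * 1) (at x)"
        by (rule DERIV_chain2[OF H'])
          (use that x r in \<open>auto simp: R_def intro!: derivative_eq_intros\<close>)
      then show "((\<lambda>t. H (\<tau> + t)) has_vector_derivative h (\<tau> + x)) (at x within {-r..r})"
        by (simp add: has_real_derivative_iff_has_vector_derivative has_vector_derivative_at_within)
    qed (use r in auto)
    then show ?thesis
      by (simp add: average_def integral_unique)
  qed
  have d1: "((\<lambda>\<tau>. H (\<tau> + r)) has_real_derivative h r) (at 0)"
    using H'[of r] r DERIV_shift[of H _ 0 r] by (simp add: R_def)
  have d2: "((\<lambda>\<tau>. H (\<tau> - r)) has_real_derivative h (- r)) (at 0)"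
    using H'[of "- r"] r DERIV_shift[of H _ 0 "- r"] by (simp add: R_def)
  have "((\<lambda>\<tau>. (H (\<tau> + r) - H (\<tau> - r)) / (2 * r)) has_real_derivative (h r - h (- r)) / (2 * r)) (at 0)"
    by (intro DERIV_cdivide DERIV_diff d1 d2)
  then show ?thesis
    by (rule DERIV_cong_ev[THEN iffD1, rotated -1])
      (use r eq in \<open>auto simp: eventually_at dist_real_def intro!: exI[of _ r] eventually_nhds_metric[THEN iffD2]\<close>)
qed

lemma average_param_derivative:
  fixes f f' :: "real \<Rightarrow> real \<Rightarrow> real"
  assumes deriv: "\<And>\<tau> t. ((\<lambda>\<tau>. f \<tau> t) has_real_derivative f' \<tau> t) (at \<tau>)"
    and f: "\<And>\<tau>. continuous_on UNIV (f \<tau>)"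
    and f': "continuous_on UNIV (\<lambda>(\<tau>, t). f' \<tau> t)"
  shows "((\<lambda>\<tau>. average r (f \<tau>)) has_real_derivative average r (f' \<tau>)) (at \<tau>)"
proof -
  have "((\<lambda>x. integral (cbox (-r) r) (f x)) has_field_derivative integral (cbox (-r) r) (f' \<tau>)) (at \<tau> within UNIV)"
    by (rule leibniz_rule_field_derivative)
      (use deriv f f' in \<open>auto intro!: integrable_continuous_interval intro: continuous_on_subset\<close>)
  then show ?thesis
    unfolding average_def by (intro DERIV_cdivide) simp
qed

section \<open>The real coordinate directions form an orthonormal system\<close>

lemma inner_single: "inner (single i c) (single j d) = (if i = j then inner c d else 0)"
proof -
  have "inner (single i c) (single j d) = (\<Sum>k. inner (coord (single i c) k) (coord (single j d) k))"
    by (rule inner_ell2_def)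
  also have "\<dots> = (\<Sum>k\<in>{i}. inner (coord (single i c) k) (coord (single j d) k))"
    by (rule suminf_finite) (auto simp: single.rep_eq)
  finally show ?thesis by (simp add: single.rep_eq)
qed

lemma inner_direction: "inner (direction u) (direction v) = (if u = v then 1 else 0)"
  by (cases u; cases v) (auto simp: inner_single inner_complex_def)

lemma norm_direction [simp]: "norm (direction v) = 1"
  by (simp add: norm_eq_sqrt_inner inner_direction)

section \<open>Composition of averages and difference quotients along an enumeration of the
  directions\<close>

instance real_var :: countable
  by countable_datatype

text \<open>Each differentiation along \<open>v\<close> uses up one position \<open>n\<close> with
  \<open>axis n = v\<close>, so derivatives of every order require infinitely many such positions.
  Summable radii bound both the total displacement and the total error of all averages.\<close>

locale mollifier =
  fixes r :: "nat \<Rightarrow> real" and axis :: "nat \<Rightarrow> real_var"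
  assumes r_pos: "0 < r n"
    and summable_r: "summable r"
    and infinitely_often: "infinite {n. axis n = v}"
begin

abbreviation e :: "nat \<Rightarrow> ell2" where "e n \<equiv> direction (axis n)"

text \<open>\<open>F\<close> is the finite set of positions at which a derivative has been taken.\<close>

definition step :: "nat set \<Rightarrow> nat \<Rightarrow> (ell2 \<Rightarrow> real) \<Rightarrow> ell2 \<Rightarrow> real" where
  "step F n f z = (if n \<in> F then (f (z + r n *\<^sub>R e n) - f (z - r n *\<^sub>R e n)) / (2 * r n)
     else average (r n) (\<lambda>t. f (z + t *\<^sub>R e n)))"

primrec steps :: "nat set \<Rightarrow> (ell2 \<Rightarrow> real) \<Rightarrow> nat \<Rightarrow> ell2 \<Rightarrow> real" where
  "steps F f 0 = f"
| "steps F f (Suc n) = step F n (steps F f n)"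

definition mollify :: "nat set \<Rightarrow> (ell2 \<Rightarrow> real) \<Rightarrow> ell2 \<Rightarrow> real" where
  "mollify F f z = lim (\<lambda>n. steps F f n z)"

text \<open>A difference quotient of radius \<open>r n\<close> multiplies a sup bound or a Lipschitz
  constant by at most 1 / r n. The maximum with 1 makes every factor at least 1, so that
  \<open>gain F\<close> also dominates the products over subsets of \<open>F\<close>.\<close>

definition gain :: "nat set \<Rightarrow> real" where
  "gain F = (\<Prod>n\<in>F. max 1 (1 / r n))"

lemma continuous_on_line:
  assumes "L-lipschitz_on UNIV (f :: ell2 \<Rightarrow> real)"
  shows "continuous_on S (\<lambda>t. f (z + t *\<^sub>R w))"
  by (rule continuous_on_compose2[OF lipschitz_on_continuous_on[OF assms]])
    (auto intro!: continuous_intros)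

text \<open>Averages of translates keep the Lipschitz constant; the two terms of the difference
  quotient contribute 2 L / (2 r n). Intersecting \<open>F\<close> with \<open>{n}\<close> covers
  both cases by one factor.\<close>

lemma step_lipschitz:
  assumes f: "L-lipschitz_on UNIV f"
  shows "(gain (F \<inter> {n}) * L)-lipschitz_on UNIV (step F n f)"
proof (rule lipschitz_onI)
  have L: "0 \<le> L" using f by (rule lipschitz_on_nonneg)
  then show "0 \<le> gain (F \<inter> {n}) * L" by (simp add: gain_def prod_nonneg)
  fix z w :: ell2
  have D: "\<bar>f (z + u) - f (w + u)\<bar> \<le> L * dist z w" for u
    using lipschitz_onD[OF f, of "z + u" "w + u"] by (simp add: dist_real_def)
  show "dist (step F n f z) (step F n f w) \<le> gain (F \<inter> {n}) * L * dist z w"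
  proof (cases "n \<in> F")
    case True
    have "step F n f z - step F n f w = ((f (z + r n *\<^sub>R e n) - f (w + r n *\<^sub>R e n)) - (f (z + - r n *\<^sub>R e n) - f (w + - r n *\<^sub>R e n))) / (2 * r n)"
      using True by (simp add: step_def diff_divide_distrib)
    moreover have "\<bar>(f (z + r n *\<^sub>R e n) - f (w + r n *\<^sub>R e n)) - (f (z + - r n *\<^sub>R e n) - f (w + - r n *\<^sub>R e n))\<bar> \<le> 2 * (L * dist z w)"
      using D[of "r n *\<^sub>R e n"] D[of "- r n *\<^sub>R e n"] by linarith
    ultimately have "\<bar>step F n f z - step F n f w\<bar> \<le> 2 * (L * dist z w) / (2 * r n)"
      using r_pos[of n] divide_right_mono[of _ "2 * (L * dist z w)" "2 * r n"] by simp
    also have "\<dots> = 1 / r n * (L * dist z w)" by simp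
    also have "\<dots> \<le> max 1 (1 / r n) * (L * dist z w)"
      using L by (intro mult_right_mono) auto
    finally show ?thesis
      using True by (simp add: dist_real_def gain_def mult.assoc)
  next
    case False
    have "step F n f z - step F n f w = average (r n) (\<lambda>t. f (z + t *\<^sub>R e n) - f (w + t *\<^sub>R e n))"
      using False by (simp add: step_def average_diff continuous_on_line[OF f])
    moreover have "\<bar>average (r n) (\<lambda>t. f (z + t *\<^sub>R e n) - f (w + t *\<^sub>R e n)) - 0\<bar> \<le> L * dist z w"
      by (rule average_close) (use r_pos D in \<open>auto intro!: continuous_intros continuous_on_line[OF f]\<close>)
    ultimately show ?thesis
      using False by (simp add: dist_real_def gain_def)
  qed
qed

lemma step_bounded:
  assumes f: "L-lipschitz_on UNIV f" and K: "\<And>z. \<bar>f z\<bar> \<le> K"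
  shows "\<bar>step F n f z\<bar> \<le> gain (F \<inter> {n}) * K"
proof (cases "n \<in> F")
  case True
  have K0: "0 \<le> K" using K[of 0] by linarith
  have "\<bar>f (z + r n *\<^sub>R e n) - f (z - r n *\<^sub>R e n)\<bar> \<le> 2 * K"
    using K[of "z + r n *\<^sub>R e n"] K[of "z - r n *\<^sub>R e n"] by linarith
  then have "\<bar>step F n f z\<bar> \<le> 2 * K / (2 * r n)"
    using True r_pos[of n] divide_right_mono[of _ "2 * K" "2 * r n"] by (simp add: step_def)
  also have "\<dots> = 1 / r n * K" by simp
  also have "\<dots> \<le> max 1 (1 / r n) * K"
    using K0 by (intro mult_right_mono) auto
  finally show ?thesis
    using True by (simp add: gain_def)
next
  case False
  have "\<bar>average (r n) (\<lambda>t. f (z + t *\<^sub>R e n)) - 0\<bar> \<le> K"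
    by (rule average_close) (use r_pos K in \<open>auto intro!: continuous_on_line[OF f]\<close>)
  then show ?thesis
    using False by (simp add: step_def gain_def)
qed

text \<open>An average compares \<open>f z\<close> only with values at distance at most
  \<open>r n\<close>, because the direction is a unit vector.\<close>

lemma step_close:
  assumes f: "L-lipschitz_on UNIV f" and n: "n \<notin> F"
  shows "\<bar>step F n f z - f z\<bar> \<le> L * r n"
  unfolding step_def if_not_P[OF n]
proof (rule average_close)
  fix t assume t: "t \<in> {- r n..r n}"
  have "\<bar>f (z + t *\<^sub>R e n) - f z\<bar> \<le> L * \<bar>t\<bar>"
    using lipschitz_onD[OF f, of "z + t *\<^sub>R e n" z] by (simp add: dist_norm)
  also have "\<dots> \<le> L * r n"
    using t lipschitz_on_nonneg[OF f] by (intro mult_left_mono) auto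
  finally show "\<bar>f (z + t *\<^sub>R e n) - f z\<bar> \<le> L * r n" .
qed (use r_pos in \<open>auto intro!: continuous_on_line[OF f]\<close>)

lemma gain_mono: "finite G \<Longrightarrow> F \<subseteq> G \<Longrightarrow> gain F \<le> gain G"
  unfolding gain_def by (rule prod_mono2) auto

lemma gain_Suc: "gain (F \<inter> {..<Suc n}) = gain (F \<inter> {n}) * gain (F \<inter> {..<n})"
proof -
  have "F \<inter> {..<Suc n} = F \<inter> {n} \<union> F \<inter> {..<n}" by auto
  then show ?thesis
    unfolding gain_def by (simp only:) (subst prod.union_disjoint; auto)
qed

lemma steps_lipschitz_aux:
  assumes "L-lipschitz_on UNIV f"
  shows "(gain (F \<inter> {..<n}) * L)-lipschitz_on UNIV (steps F f n)"
proof (induction n)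
  case 0
  then show ?case using assms by (simp add: gain_def)
next
  case (Suc n)
  then show ?case
    using step_lipschitz[OF Suc, of F n] by (simp add: gain_Suc mult.assoc)
qed

context
  fixes F :: "nat set" and f :: "ell2 \<Rightarrow> real" and L K :: real
  assumes F: "finite F" and f: "L-lipschitz_on UNIV f" and K: "\<And>z. \<bar>f z\<bar> \<le> K"
begin

lemma steps_lipschitz: "(gain F * L)-lipschitz_on UNIV (steps F f n)"
  by (rule lipschitz_on_le[OF steps_lipschitz_aux[OF f]])
    (intro mult_right_mono gain_mono F lipschitz_on_nonneg[OF f]; auto)

lemma steps_bounded: "\<bar>steps F f n z\<bar> \<le> gain F * K"
proof -
  have "\<bar>steps F f n z\<bar> \<le> gain (F \<inter> {..<n}) * K" for z
  proof (induction n arbitrary: z)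
    case 0
    then show ?case using K by (simp add: gain_def)
  next
    case (Suc n)
    then show ?case
      using step_bounded[OF steps_lipschitz Suc, of F n z] by (simp add: gain_Suc mult.assoc)
  qed
  also have "gain (F \<inter> {..<n}) * K \<le> gain F * K"
    by (intro mult_right_mono gain_mono F) (use K[of 0] in auto)
  finally show ?thesis .
qed

text \<open>Beyond the finite set \<open>F\<close> every step is an average, so the increments of
  the telescoping series are at most \<open>gain F * L * r n\<close>, uniformly in the point. The
  Weierstrass test applies from there on; the difference quotients before need not be small.\<close>

lemma steps_uniform_limit: "uniform_limit UNIV (steps F f) (mollify F f) sequentially"
proof -
  define s where "s z = f z + (\<Sum>i. steps F f (Suc i) z - steps F f i z)" for z
  obtain k where "F \<subseteq> {..<k}"
    using finite_nat_bounded[OF F] by blast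
  then have "\<forall>\<^sub>F n in sequentially. n \<notin> F"
    by (auto simp: eventually_sequentially intro!: exI[of _ k])
  then have "\<forall>\<^sub>F n in sequentially. \<forall>z\<in>UNIV. norm (steps F f (Suc n) z - steps F f n z) \<le> gain F * L * r n"
    by eventually_elim (use step_close[OF steps_lipschitz] in auto)
  then have "uniform_limit UNIV (\<lambda>n z. \<Sum>i<n. steps F f (Suc i) z - steps F f i z)
      (\<lambda>z. \<Sum>i. steps F f (Suc i) z - steps F f i z) sequentially"
    by (rule Weierstrass_m_test_ev) (intro summable_mult summable_r)
  then have "uniform_limit UNIV (\<lambda>n z. f z + (\<Sum>i<n. steps F f (Suc i) z - steps F f i z)) s sequentially"
    unfolding s_def by (intro uniform_limit_intros)
  moreover have "f z + (\<Sum>i<n. steps F f (Suc i) z - steps F f i z) = steps F f n z" for n z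
    by (induction n) auto
  ultimately have *: "uniform_limit UNIV (steps F f) s sequentially"
    by simp
  then have "(\<lambda>n. steps F f n z) \<longlonglongrightarrow> s z" for z
    by (rule tendsto_uniform_limitI) simp
  then have "mollify F f = s"
    by (simp add: mollify_def fun_eq_iff limI)
  with * show ?thesis by simp
qed

lemma steps_tendsto: "(\<lambda>n. steps F f n z) \<longlonglongrightarrow> mollify F f z"
  by (rule tendsto_uniform_limitI[OF steps_uniform_limit]) simp

lemma mollify_lipschitz: "(gain F * L)-lipschitz_on UNIV (mollify F f)"
proof (rule lipschitz_onI)
  show "dist (mollify F f z) (mollify F f w) \<le> gain F * L * dist z w" for z w
    by (rule LIMSEQ_le_const2[OF tendsto_dist[OF steps_tendsto steps_tendsto]])
      (use lipschitz_onD[OF steps_lipschitz] in blast)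
qed (use lipschitz_on_nonneg[OF steps_lipschitz] in blast)

lemma mollify_bounded: "\<bar>mollify F f z\<bar> \<le> gain F * K"
  by (rule LIMSEQ_le_const2[OF tendsto_rabs[OF steps_tendsto]]) (use steps_bounded in blast)

text \<open>The first \<open>n\<close> steps use only values of \<open>f\<close> within distance r 0
  + ... + r (n - 1) of the point. The induction is therefore run with partial sums of the radii, and
  for all base points at once.\<close>

lemma mollify_eq_0:
  assumes "\<And>w. norm (w - z) \<le> suminf r \<Longrightarrow> f w = 0"
  shows "mollify F f z = 0"
proof -
  have "steps F f n z = 0" if "\<And>w. norm (w - z) \<le> sum r {..<n} \<Longrightarrow> f w = 0" for n
    using that
  proof (induction n arbitrary: z)
    case 0
    then show ?case by simp
  next
    case (Suc n)
    have *: "steps F f n (z + t *\<^sub>R e n) = 0" if t: "\<bar>t\<bar> \<le> r n" for t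
    proof (rule Suc.IH)
      fix w assume w: "norm (w - (z + t *\<^sub>R e n)) \<le> sum r {..<n}"
      have "norm (w - z) \<le> norm (w - (z + t *\<^sub>R e n)) + norm (t *\<^sub>R e n)"
        using norm_triangle_ineq[of "w - (z + t *\<^sub>R e n)" "t *\<^sub>R e n"] by simp
      then show "f w = 0"
        using w t by (intro Suc.prems) simp
    qed
    have "average (r n) (\<lambda>t. steps F f n (z + t *\<^sub>R e n)) = 0"
      unfolding average_def using * by (subst integral_cong[where g = "\<lambda>_. 0"]) auto
    moreover have "steps F f n (z + r n *\<^sub>R e n) = 0" "steps F f n (z - r n *\<^sub>R e n) = 0"
      using *[of "r n"] *[of "- r n"] r_pos[of n] by auto
    ultimately show ?case by (simp add: step_def)
  qed
  moreover have "sum r {..<n} \<le> suminf r" for n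
    using summable_r r_pos by (intro sum_le_suminf) (auto intro: less_imp_le)
  ultimately have "steps F f n z = 0" for n
    using assms by (meson order_trans)
  then show ?thesis by (simp add: mollify_def)
qed

end

text \<open>Without difference quotients the Lipschitz constant remains \<open>L\<close> throughout,
  so the errors \<open>L * r n\<close> of the single steps simply add up.\<close>

lemma mollify_close:
  assumes "L-lipschitz_on UNIV f" "\<And>z. \<bar>f z\<bar> \<le> K"
  shows "\<bar>mollify {} f z - f z\<bar> \<le> L * suminf r"
proof (rule LIMSEQ_le_const2)
  show "(\<lambda>n. \<bar>steps {} f n z - f z\<bar>) \<longlonglongrightarrow> \<bar>mollify {} f z - f z\<bar>"
    by (intro tendsto_intros steps_tendsto[OF _ assms]) simp
  have L: "0 \<le> L" using assms(1) by (rule lipschitz_on_nonneg)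
  have "\<bar>steps {} f n z - f z\<bar> \<le> L * sum r {..<n}" for n
  proof (induction n)
    case (Suc n)
    have "L-lipschitz_on UNIV (steps {} f n)"
      using steps_lipschitz[OF _ assms, of "{}" n] by (simp add: gain_def)
    from step_close[OF this, of n "{}" z] Suc show ?case
      by (simp add: distrib_left)
  qed simp
  also have "L * sum r {..<n} \<le> L * suminf r" for n
    using summable_r r_pos L by (intro mult_left_mono sum_le_suminf) (auto intro: less_imp_le)
  finally show "\<exists>N. \<forall>n\<ge>N. \<bar>steps {} f n z - f z\<bar> \<le> L * suminf r" by blast
qed

lemma mollify_nonneg:
  assumes "L-lipschitz_on UNIV f" "\<And>z. \<bar>f z\<bar> \<le> K" "\<And>z. 0 \<le> f z"
  shows "0 \<le> mollify {} f z"
proof (rule LIMSEQ_le_const[OF steps_tendsto[OF _ assms(1,2)]])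
  have "0 \<le> steps {} f n z" for n z
  proof (induction n arbitrary: z)
    case (Suc n)
    then show ?case
      using average_nonneg[OF r_pos continuous_on_line[OF steps_lipschitz[OF _ assms(1,2)]]]
      by (simp add: step_def)
  qed (simp add: assms)
  then show "\<exists>N. \<forall>n\<ge>N. 0 \<le> steps {} f n z" by blast
qed simp

section \<open>Partial derivatives of mollified functions\<close>

lemma steps_cong: "(\<And>i. i < n \<Longrightarrow> i \<in> F \<longleftrightarrow> i \<in> G) \<Longrightarrow> steps F f n = steps G f n"
proof (induction n)
  case (Suc n)
  then have "steps F f n = steps G f n" "n \<in> F \<longleftrightarrow> n \<in> G"
    by simp_all
  then show ?case by (simp only: steps.simps step_def)
qed simp

text \<open>Differentiation along \<open>e k\<close> commutes with every step after position
  \<open>k\<close>: with difference quotients by linearity, with averages by the Leibniz rule. At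
  position \<open>k\<close> it turns the average into the difference quotient, and before
  \<open>k\<close> both sequences coincide. The condition \<open>k < n\<close> ensures that this
  average has been taken.\<close>

lemma steps_derivative:
  assumes F: "finite F" and f: "L-lipschitz_on UNIV f" and K: "\<And>z. \<bar>f z\<bar> \<le> K"
    and k: "k \<notin> F" "k < n"
  shows "((\<lambda>\<tau>. steps F f n (z + \<tau> *\<^sub>R e k)) has_real_derivative
    steps (insert k F) f n (z + \<tau> *\<^sub>R e k)) (at \<tau>)"
proof -
  have "((\<lambda>\<tau>. steps F f n (z + \<tau> *\<^sub>R e k)) has_real_derivative steps (insert k F) f n z) (at 0)" for z
    using k(2)
  proof (induction n arbitrary: z)
    case 0
    then show ?case by simp
  next
    case (Suc n)
    note lip = steps_lipschitz[OF F f K, of n]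
    note lip' = steps_lipschitz[OF finite.insertI[OF F, of k] f K, of n]
    show ?case
    proof (cases "n = k")
      case True
      have "steps (insert k F) f n = steps F f n"
        by (rule steps_cong) (use True in auto)
      moreover have "((\<lambda>\<tau>. average (r n) (\<lambda>t. steps F f n (z + (\<tau> + t) *\<^sub>R e n))) has_real_derivative
          (steps F f n (z + r n *\<^sub>R e n) - steps F f n (z + - r n *\<^sub>R e n)) / (2 * r n)) (at 0)"
        by (rule average_shift_derivative) (rule r_pos, rule continuous_on_line[OF lip])
      ultimately show ?thesis
        using True k(1) by (simp add: step_def algebra_simps)
    next
      case False
      with Suc.prems have "k < n" by simp
      \<comment> \<open>Moving the base point along the line extends the induction hypothesis from 0
        to every \<tau>, as differentiation under the integral requires.\<close>
      have D: "((\<lambda>\<tau>. steps F f n (w + \<tau> *\<^sub>R e k)) has_real_derivative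
          steps (insert k F) f n (w + \<tau> *\<^sub>R e k)) (at \<tau>)" for w \<tau>
        using DERIV_shift[of "\<lambda>\<tau>. steps F f n (w + \<tau> *\<^sub>R e k)" _ 0 \<tau>]
          Suc.IH[OF \<open>k < n\<close>, of "w + \<tau> *\<^sub>R e k"]
        by (simp add: algebra_simps)
      show ?thesis
      proof (cases "n \<in> F")
        case True
        have "((\<lambda>\<tau>. (steps F f n ((z + r n *\<^sub>R e n) + \<tau> *\<^sub>R e k) - steps F f n ((z - r n *\<^sub>R e n) + \<tau> *\<^sub>R e k)) / (2 * r n))
          has_real_derivative (steps (insert k F) f n ((z + r n *\<^sub>R e n) + 0 *\<^sub>R e k) -
            steps (insert k F) f n ((z - r n *\<^sub>R e n) + 0 *\<^sub>R e k)) / (2 * r n)) (at 0)"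
          by (intro DERIV_cdivide DERIV_diff D)
        then show ?thesis
          using True by (simp add: step_def algebra_simps)
      next
        case nF: False
        have "((\<lambda>\<tau>. average (r n) (\<lambda>t. steps F f n ((z + t *\<^sub>R e n) + \<tau> *\<^sub>R e k))) has_real_derivative
          average (r n) (\<lambda>t. steps (insert k F) f n ((z + t *\<^sub>R e n) + 0 *\<^sub>R e k))) (at 0)"
        proof (rule average_param_derivative[OF D])
          show "continuous_on UNIV (\<lambda>t. steps F f n ((z + t *\<^sub>R e n) + \<tau> *\<^sub>R e k))" for \<tau>
            using continuous_on_line[OF lip, of UNIV "z + \<tau> *\<^sub>R e k"] by (simp add: algebra_simps)
          show "continuous_on UNIV (\<lambda>(\<tau>, t). steps (insert k F) f n ((z + t *\<^sub>R e n) + \<tau> *\<^sub>R e k))"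
            unfolding case_prod_beta
            by (rule continuous_on_compose2[OF lipschitz_on_continuous_on[OF lip']])
              (auto intro!: continuous_intros)
        qed
        then show ?thesis
          using nF False by (simp add: step_def algebra_simps)
      qed
    qed
  qed
  from this[of "z + \<tau> *\<^sub>R e k"] show ?thesis
    using DERIV_shift[of "\<lambda>\<tau>. steps F f n (z + \<tau> *\<^sub>R e k)" _ 0 \<tau>] by (simp add: algebra_simps)
qed

text \<open>The derivatives of the finite stages are themselves stages of a mollification, hence
  converge uniformly, and so limit and derivative may be exchanged.\<close>

lemma mollify_derivative:
  assumes F: "finite F" and f: "L-lipschitz_on UNIV f" and K: "\<And>z. \<bar>f z\<bar> \<le> K"
    and k: "k \<notin> F"
  shows "((\<lambda>\<tau>. mollify F f (z + \<tau> *\<^sub>R e k)) has_real_derivative mollify (insert k F) f z) (at 0)"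
proof -
  \<comment> \<open>The index shift makes position \<open>k\<close> precede every stage
    considered.\<close>
  let ?f = "\<lambda>n \<tau>. steps F f (n + Suc k) (z + \<tau> *\<^sub>R e k)"
  let ?f' = "\<lambda>n \<tau> h. steps (insert k F) f (n + Suc k) (z + \<tau> *\<^sub>R e k) * h"
  let ?g' = "\<lambda>\<tau> h. mollify (insert k F) f (z + \<tau> *\<^sub>R e k) * h"
  have lim: "(\<lambda>n. ?f n \<tau>) \<longlonglongrightarrow> mollify F f (z + \<tau> *\<^sub>R e k)" for \<tau>
    by (rule LIMSEQ_ignore_initial_segment[OF steps_tendsto[OF F f K]])
  have ul: "uniform_limit UNIV (steps (insert k F) f) (mollify (insert k F) f) sequentially"
    using steps_uniform_limit[OF _ f K] F by blast
  have "\<exists>g. \<forall>\<tau>\<in>UNIV. (\<lambda>n. ?f n \<tau>) \<longlonglongrightarrow> g \<tau> \<and> (g has_derivative ?g' \<tau>) (at \<tau> within UNIV)"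
  proof (rule has_derivative_sequence[where f' = ?f'])
    show "(?f n has_derivative ?f' n \<tau>) (at \<tau> within UNIV)" for n \<tau>
      using steps_derivative[OF F f K k, of "n + Suc k" z \<tau>] by (simp add: has_field_derivative_def)
    show "\<forall>\<^sub>F n in sequentially. \<forall>\<tau>\<in>UNIV. \<forall>h. norm (?f' n \<tau> h - ?g' \<tau> h) \<le> \<epsilon> * norm h"
      if "\<epsilon> > 0" for \<epsilon>
    proof -
      have "\<forall>\<^sub>F n in sequentially. \<forall>w\<in>UNIV. dist (steps (insert k F) f n w) (mollify (insert k F) f w) < \<epsilon>"
        using ul that by (simp add: uniform_limit_iff)
      then have "\<forall>\<^sub>F n in sequentially. \<forall>w\<in>UNIV. dist (steps (insert k F) f (n + Suc k) w) (mollify (insert k F) f w) < \<epsilon>"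
        by (subst eventually_sequentially_seg)
      moreover have "norm (a * h - b * h) \<le> \<epsilon> * norm h" if "dist a b < \<epsilon>" for a b h :: real
        using that by (simp add: dist_real_def abs_mult left_diff_distrib[symmetric] mult_right_mono)
      ultimately show ?thesis
        by (auto elim!: eventually_mono simp del: steps.simps)
    qed
  qed (use lim in auto)
  then obtain g where g: "\<And>\<tau>. (\<lambda>n. ?f n \<tau>) \<longlonglongrightarrow> g \<tau>" "\<And>\<tau>. (g has_derivative ?g' \<tau>) (at \<tau>)"
    by auto
  have "g = (\<lambda>\<tau>. mollify F f (z + \<tau> *\<^sub>R e k))"
    using LIMSEQ_unique[OF g(1) lim] by blast
  with g(2)[of 0] show ?thesis
    by (simp add: has_field_derivative_def)
qed

end

section \<open>Gradients of Lipschitz functions\<close>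

text \<open>This is the classical passage from continuous partial derivatives to directional ones,
  with one direction added at a time. In the plane spanned by the old vector \<open>w\<close> and
  the new direction, the derivative along \<open>w\<close> is needed only at the base point, while
  the one along the new direction exists everywhere and is continuous.\<close>

lemma has_real_derivative_span_direction:
  assumes deriv: "\<And>v z. ((\<lambda>\<tau>. g (z + \<tau> *\<^sub>R direction v)) has_real_derivative D v z) (at 0)"
    and cont: "\<And>v. continuous_on UNIV (D v)"
    and A: "finite A"
  shows "((\<lambda>s. g (z + s *\<^sub>R (\<Sum>v\<in>A. c v *\<^sub>R direction v))) has_real_derivative (\<Sum>v\<in>A. c v * D v z)) (at 0)"
  using A
proof induction
  case empty
  then show ?case by simp
next
  case (insert u A)
  define w where "w = (\<Sum>v\<in>A. c v *\<^sub>R direction v)"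
  define d where "d = (\<Sum>v\<in>A. c v * D v z)"
  have fx: "((\<lambda>s. g (z + s *\<^sub>R w + 0 *\<^sub>R direction u)) has_derivative (*) d) (at 0 within UNIV)"
    using insert.IH by (simp add: w_def d_def has_field_derivative_def)
  have fy: "((\<lambda>t. g (z + s *\<^sub>R w + t *\<^sub>R direction u)) has_derivative
      blinfun_apply (blinfun_mult_right (D u (z + s *\<^sub>R w + t *\<^sub>R direction u)))) (at t within UNIV)" for s t
    using DERIV_shift[of "\<lambda>t. g (z + s *\<^sub>R w + t *\<^sub>R direction u)" _ 0 t]
      deriv[of "z + s *\<^sub>R w + t *\<^sub>R direction u" u]
    by (simp add: has_field_derivative_def algebra_simps)
  have "continuous_on UNIV (\<lambda>(s, t). blinfun_mult_right (D u (z + s *\<^sub>R w + t *\<^sub>R direction u)))"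
    unfolding case_prod_beta
    by (intro bounded_linear.continuous_on[OF bounded_linear_blinfun_mult_right]
        continuous_on_compose2[OF cont]) (auto intro!: continuous_intros)
  then have fy_cont: "continuous (at (0, 0) within UNIV \<times> UNIV)
      (\<lambda>(s, t). blinfun_mult_right (D u (z + s *\<^sub>R w + t *\<^sub>R direction u)))"
    by (simp add: continuous_on_eq_continuous_within)
  have "((\<lambda>(s, t). g (z + s *\<^sub>R w + t *\<^sub>R direction u)) has_derivative
      (\<lambda>(x, y). d * x + blinfun_mult_right (D u (z + 0 *\<^sub>R w + 0 *\<^sub>R direction u)) y))
      (at (0, 0) within UNIV \<times> UNIV)"
    by (rule has_derivative_partialsI[OF fx fy fy_cont]) auto
  then have "((\<lambda>(s, t). g (z + s *\<^sub>R w + t *\<^sub>R direction u)) has_derivative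
      (\<lambda>(x, y). d * x + D u z * y)) (at (0, c u * 0))"
    by simp
  \<comment> \<open>The two-variable derivative is restricted to the line t = c u * s by the chain
    rule.\<close>
  moreover have "((\<lambda>s. (s, c u * s)) has_derivative (\<lambda>x. (x, c u * x))) (at 0)"
    by (auto intro!: derivative_eq_intros)
  ultimately have "((\<lambda>s. g (z + s *\<^sub>R w + (c u * s) *\<^sub>R direction u)) has_derivative
      (\<lambda>x. d * x + D u z * (c u * x))) (at 0)"
    using has_derivative_compose[of "\<lambda>s. (s, c u * s)" "\<lambda>x. (x, c u * x)" 0 UNIV] by fastforce
  moreover have "(\<lambda>x. d * x + D u z * (c u * x)) = (*) (c u * D u z + d)"
    by (auto simp: algebra_simps)
  ultimately show ?case
    using insert.hyps by (simp add: has_field_derivative_def w_def d_def algebra_simps)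
qed

lemma norm_sum_direction:
  assumes "finite A"
  shows "(norm (\<Sum>v\<in>A. c v *\<^sub>R direction v))\<^sup>2 = (\<Sum>v\<in>A. (c v)\<^sup>2)"
  using assms unfolding power2_norm_eq_inner
  by (simp add: inner_sum_left inner_sum_right inner_direction
      if_distrib sum.delta power2_eq_square cong: if_cong)

text \<open>Let \<open>w\<close> be the gradient truncated to \<open>A\<close>. The derivative along
  \<open>w\<close> is the square of \<open>norm w\<close> and is at most \<open>L * norm w\<close>;
  cancelling gives \<open>norm w \<le> L\<close>, with no dependence on the size of
  \<open>A\<close>.\<close>

lemma lipschitz_gradient_bound:
  assumes g: "L-lipschitz_on UNIV g"
    and deriv: "\<And>v z. ((\<lambda>\<tau>. g (z + \<tau> *\<^sub>R direction v)) has_real_derivative D v z) (at 0)"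
    and cont: "\<And>v. continuous_on UNIV (D v)"
    and A: "finite A"
  shows "(\<Sum>v\<in>A. (D v z)\<^sup>2) \<le> L\<^sup>2"
proof -
  define w where "w = (\<Sum>v\<in>A. D v z *\<^sub>R direction v)"
  define S where "S = (\<Sum>v\<in>A. (D v z)\<^sup>2)"
  have S: "(norm w)\<^sup>2 = S"
    using A by (simp add: w_def S_def norm_sum_direction)
  have "((\<lambda>s. g (z + s *\<^sub>R w)) has_real_derivative S) (at 0)"
    using has_real_derivative_span_direction[OF deriv cont A, of z "\<lambda>v. D v z"]
    by (simp add: w_def S_def power2_eq_square)
  then have lim: "(\<lambda>s. (g (z + s *\<^sub>R w) - g z) / s) \<midarrow>0\<rightarrow> S"
    by (simp add: DERIV_def)
  have "norm S \<le> L * norm w"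
  proof (rule Lim_norm_ubound[OF _ lim])
    have "norm ((g (z + s *\<^sub>R w) - g z) / s) \<le> L * norm w" if "s \<noteq> 0" for s
      using lipschitz_onD[OF g, of "z + s *\<^sub>R w" z] that
      by (simp add: dist_norm abs_divide pos_divide_le_eq mult_ac)
    then show "\<forall>\<^sub>F s in at 0. norm ((g (z + s *\<^sub>R w) - g z) / s) \<le> L * norm w"
      by (auto simp: eventually_at_filter)
  qed simp
  then have "norm w * norm w \<le> L * norm w"
    by (simp add: S[symmetric] power2_eq_square)
  then have "norm w \<le> L"
    using lipschitz_on_nonneg[OF g] by (cases "norm w = 0") (auto simp: mult_le_cancel_right)
  then show ?thesis
    using S by (metis S_def norm_ge_zero power_mono)
qed

section \<open>Functions with locally bounded derivatives\<close>

lemma has_partial_iff: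
  "has_partial v f z \<longleftrightarrow> ((\<lambda>\<tau>. f (z + \<tau> *\<^sub>R direction v)) has_vector_derivative partial v f z) (at 0)"
  by (metis differentiableI_vector has_partial_def partial_def vector_derivative_works)

lemma partialI:
  assumes "((\<lambda>\<tau>. f (z + \<tau> *\<^sub>R direction v)) has_vector_derivative d) (at 0)"
  shows "has_partial v f z" "partial v f z = d"
  using assms differentiableI_vector vector_derivative_at
  unfolding has_partial_def partial_def by blast+

text \<open>For small \<tau> the line through \<open>z\<close> stays in the open set, so both
  functions agree along it near \<tau> = 0.\<close>

lemma partial_cong:
  assumes "open V" "z \<in> V" "\<And>z. z \<in> V \<Longrightarrow> f z = g z"
  shows "has_partial v f z \<longleftrightarrow> has_partial v g z" "partial v f z = partial v g z"
proof -
  have "isCont (\<lambda>\<tau>. z + \<tau> *\<^sub>R direction v) 0"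
    by (intro continuous_intros)
  then have "((\<lambda>\<tau>. z + \<tau> *\<^sub>R direction v) \<longlongrightarrow> z) (nhds 0)"
    by (simp add: isCont_def tendsto_at_iff_tendsto_nhds[symmetric] continuous_at tendsto_nhds_iff)
  then have "\<forall>\<^sub>F \<tau> in nhds 0. z + \<tau> *\<^sub>R direction v \<in> V"
    using assms(1,2) by (rule topological_tendstoD)
  then have ev: "\<forall>\<^sub>F \<tau> in nhds 0. f (z + \<tau> *\<^sub>R direction v) = g (z + \<tau> *\<^sub>R direction v)"
    by eventually_elim (rule assms(3))
  then show p: "partial v f z = partial v g z"
    unfolding partial_def by (intro vector_derivative_cong_eq) auto
  show "has_partial v f z \<longleftrightarrow> has_partial v g z"
    unfolding has_partial_iff p by (rule has_vector_derivative_cong_ev) (use ev in \<open>auto dest: eventually_nhds_x_imp_x\<close>)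
qed

text \<open>This is the bound in \<open>C1_F\<close> written with real partial derivatives. Bounding
  all finite subsums avoids infinite series, and one constant \<open>K\<close> serves for the
  function and for its gradient. Continuity of the partial derivatives enters once all iterated
  derivatives are required to be tame.\<close>

definition tame :: "ell2 set \<Rightarrow> (ell2 \<Rightarrow> complex) \<Rightarrow> bool" where
  "tame V f \<longleftrightarrow> continuous_on V f \<and> (\<forall>z\<in>V. \<forall>v. has_partial v f z) \<and>
    (\<forall>S. uniformly_included S V \<longrightarrow> (\<exists>K. \<forall>z\<in>S. cmod (f z) \<le> K \<and>
      (\<forall>A. finite A \<longrightarrow> (\<Sum>v\<in>A. (cmod (partial v f z))\<^sup>2) \<le> K)))"

definition all_tame :: "ell2 set \<Rightarrow> (ell2 \<Rightarrow> complex) \<Rightarrow> bool" where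
  "all_tame V f \<longleftrightarrow> (\<forall>vs. tame V (iter_partial vs f))"

lemma uniformly_included_subset: "uniformly_included S V \<Longrightarrow> S \<subseteq> V"
  by (auto simp: uniformly_included_def)

lemma uniformly_included_bounded: "uniformly_included S V \<Longrightarrow> bounded S"
  by (auto simp: uniformly_included_def)

lemma uniformly_included_UNIV: "bounded S \<Longrightarrow> uniformly_included S UNIV"
  by (simp add: uniformly_included_def bdry_dist_def)

lemma tameE:
  assumes "tame V f" "uniformly_included S V"
  obtains K where "0 \<le> K" "\<And>z. z \<in> S \<Longrightarrow> cmod (f z) \<le> K"
    "\<And>z A. z \<in> S \<Longrightarrow> finite A \<Longrightarrow> (\<Sum>v\<in>A. (cmod (partial v f z))\<^sup>2) \<le> K"
proof -
  obtain K where K: "\<forall>z\<in>S. cmod (f z) \<le> K \<and> (\<forall>A. finite A \<longrightarrow> (\<Sum>v\<in>A. (cmod (partial v f z))\<^sup>2) \<le> K)"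
    using assms unfolding tame_def by blast
  show ?thesis
    \<comment> \<open>If \<open>S\<close> is empty, the given \<open>K\<close> may be
      negative.\<close>
    by (rule that[of "max 0 K"]) (use K in \<open>auto intro: le_max_iff_disj[THEN iffD2]\<close>)
qed

lemma tame_cong:
  assumes V: "open V" and eq: "\<And>z. z \<in> V \<Longrightarrow> f z = g z" and f: "tame V f"
  shows "tame V g"
  unfolding tame_def
proof (intro conjI allI ballI impI)
  show "continuous_on V g"
    using f eq by (auto simp: tame_def cong: continuous_on_cong)
  show "has_partial v g z" if "z \<in> V" for z v
    using f that partial_cong(1)[OF V that eq] by (auto simp: tame_def)
  fix S assume S: "uniformly_included S V"
  obtain K where "\<And>z. z \<in> S \<Longrightarrow> cmod (f z) \<le> K"
    "\<And>z A. z \<in> S \<Longrightarrow> finite A \<Longrightarrow> (\<Sum>v\<in>A. (cmod (partial v f z))\<^sup>2) \<le> K"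
    using f S by (rule tameE) blast
  moreover have "f z = g z" "partial v f z = partial v g z" if "z \<in> S" for z v
    using that uniformly_included_subset[OF S] eq partial_cong(2)[OF V _ eq] by auto
  ultimately show "\<exists>K. \<forall>z\<in>S. cmod (g z) \<le> K \<and> (\<forall>A. finite A \<longrightarrow> (\<Sum>v\<in>A. (cmod (partial v g z))\<^sup>2) \<le> K)"
    by (intro exI[of _ K]) simp
qed

lemma partial_add:
  assumes "has_partial v f z" "has_partial v g z"
  shows "has_partial v (\<lambda>z. f z + g z) z" "partial v (\<lambda>z. f z + g z) z = partial v f z + partial v g z"
  using assms partialI[OF has_vector_derivative_add] unfolding has_partial_iff[of v f] has_partial_iff[of v g]
  by blast+

lemma partial_cmult:
  assumes "has_partial v f z"
  shows "has_partial v (\<lambda>z. c * f z) z" "partial v (\<lambda>z. c * f z) z = c * partial v f z"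
  using assms partialI[OF has_vector_derivative_mult_right] unfolding has_partial_iff[of v f]
  by blast+

lemma tame_add:
  assumes f: "tame V f" and g: "tame V g"
  shows "tame V (\<lambda>z. f z + g z)"
  unfolding tame_def
proof (intro conjI allI ballI impI)
  show "continuous_on V (\<lambda>z. f z + g z)"
    using f g by (auto simp: tame_def intro!: continuous_intros)
  show "has_partial v (\<lambda>z. f z + g z) z" if "z \<in> V" for z v
    using f g that by (auto simp: tame_def intro: partial_add)
  fix S assume S: "uniformly_included S V"
  obtain K where K: "0 \<le> K" "\<And>z. z \<in> S \<Longrightarrow> cmod (f z) \<le> K"
    "\<And>z A. z \<in> S \<Longrightarrow> finite A \<Longrightarrow> (\<Sum>v\<in>A. (cmod (partial v f z))\<^sup>2) \<le> K"
    using f S by (rule tameE) blast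
  obtain M where M: "0 \<le> M" "\<And>z. z \<in> S \<Longrightarrow> cmod (g z) \<le> M"
    "\<And>z A. z \<in> S \<Longrightarrow> finite A \<Longrightarrow> (\<Sum>v\<in>A. (cmod (partial v g z))\<^sup>2) \<le> M"
    using g S by (rule tameE) blast
  show "\<exists>K. \<forall>z\<in>S. cmod (f z + g z) \<le> K \<and>
      (\<forall>A. finite A \<longrightarrow> (\<Sum>v\<in>A. (cmod (partial v (\<lambda>z. f z + g z) z))\<^sup>2) \<le> K)"
  proof (intro exI ballI conjI allI impI)
    fix z assume z: "z \<in> S"
    \<comment> \<open>The factors 2 come from the bound for the squared norm of a sum; the same
      constant also dominates K + M.\<close>
    show "cmod (f z + g z) \<le> 2 * K + 2 * M"
      using norm_triangle_ineq[of "f z" "g z"] K(1) K(2)[OF z] M(1) M(2)[OF z] by linarith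
    fix A :: "real_var set" assume A: "finite A"
    have "partial v (\<lambda>z. f z + g z) z = partial v f z + partial v g z" for v
      using f g z uniformly_included_subset[OF S] by (intro partial_add) (auto simp: tame_def)
    then have "(\<Sum>v\<in>A. (cmod (partial v (\<lambda>z. f z + g z) z))\<^sup>2)
        \<le> (\<Sum>v\<in>A. 2 * (cmod (partial v f z))\<^sup>2 + 2 * (cmod (partial v g z))\<^sup>2)"
      by (simp add: sum_mono cmod_add_sq_le)
    also have "\<dots> \<le> 2 * K + 2 * M"
      unfolding sum.distrib sum_distrib_left[symmetric]
      using K(3)[OF z A] M(3)[OF z A] by linarith
    finally show "(\<Sum>v\<in>A. (cmod (partial v (\<lambda>z. f z + g z) z))\<^sup>2) \<le> 2 * K + 2 * M" .
  qed
qed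

lemma tame_cmult:
  assumes f: "tame V f"
  shows "tame V (\<lambda>z. c * f z)"
  unfolding tame_def
proof (intro conjI allI ballI impI)
  show "continuous_on V (\<lambda>z. c * f z)"
    using f by (auto simp: tame_def intro!: continuous_intros)
  show "has_partial v (\<lambda>z. c * f z) z" if "z \<in> V" for z v
    using f that by (auto simp: tame_def intro: partial_cmult)
  fix S assume S: "uniformly_included S V"
  obtain K where K: "0 \<le> K" "\<And>z. z \<in> S \<Longrightarrow> cmod (f z) \<le> K"
    "\<And>z A. z \<in> S \<Longrightarrow> finite A \<Longrightarrow> (\<Sum>v\<in>A. (cmod (partial v f z))\<^sup>2) \<le> K"
    using f S by (rule tameE) blast
  show "\<exists>K. \<forall>z\<in>S. cmod (c * f z) \<le> K \<and>
      (\<forall>A. finite A \<longrightarrow> (\<Sum>v\<in>A. (cmod (partial v (\<lambda>z. c * f z) z))\<^sup>2) \<le> K)"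
  proof (intro exI ballI conjI allI impI)
    fix z assume z: "z \<in> S"
    have "cmod (c * f z) \<le> cmod c * K"
      using K(2)[OF z] by (simp add: norm_mult mult_left_mono)
    moreover have nonneg: "0 \<le> (cmod c)\<^sup>2 * K" "0 \<le> cmod c * K"
      using K(1) by simp_all
    ultimately show "cmod (c * f z) \<le> cmod c * K + (cmod c)\<^sup>2 * K"
      by linarith
    fix A :: "real_var set" assume A: "finite A"
    have "partial v (\<lambda>z. c * f z) z = c * partial v f z" for v
      using f z uniformly_included_subset[OF S] by (intro partial_cmult) (auto simp: tame_def)
    then have "(\<Sum>v\<in>A. (cmod (partial v (\<lambda>z. c * f z) z))\<^sup>2) = (cmod c)\<^sup>2 * (\<Sum>v\<in>A. (cmod (partial v f z))\<^sup>2)"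
      by (simp add: norm_mult power_mult_distrib sum_distrib_left)
    also have "\<dots> \<le> (cmod c)\<^sup>2 * K"
      by (intro mult_left_mono K(3)[OF z A]) simp
    finally show "(\<Sum>v\<in>A. (cmod (partial v (\<lambda>z. c * f z) z))\<^sup>2) \<le> cmod c * K + (cmod c)\<^sup>2 * K"
      using nonneg(2) by linarith
  qed
qed

section \<open>Iterated partial derivatives\<close>

lemma iter_partial_Nil [simp]: "iter_partial [] f = f"
  by (simp add: iter_partial_def)

lemma iter_partial_Cons [simp]: "iter_partial (v # vs) f = partial v (iter_partial vs f)"
  by (simp add: iter_partial_def)

lemma iter_partial_cong:
  assumes V: "open V" and eq: "\<And>z. z \<in> V \<Longrightarrow> f z = g z"
  shows "z \<in> V \<Longrightarrow> iter_partial vs f z = iter_partial vs g z"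
  by (induction vs arbitrary: z) (auto simp: eq intro: partial_cong(2)[OF V])

text \<open>Existence of the partial derivatives is known on \<open>V\<close> only, so iterated
  derivatives are additive only there. The tameness of the sum is carried over by
  \<open>tame_cong\<close>.\<close>

lemma all_tame_add:
  assumes V: "open V" and f: "all_tame V f" and g: "all_tame V g"
  shows "all_tame V (\<lambda>z. f z + g z)"
proof -
  have eq: "iter_partial vs f z + iter_partial vs g z = iter_partial vs (\<lambda>z. f z + g z) z"
    if "z \<in> V" for vs z
    using that
  proof (induction vs arbitrary: z)
    case (Cons v vs)
    have "has_partial v (iter_partial vs f) z" "has_partial v (iter_partial vs g) z"
      using f g Cons.prems by (auto simp: all_tame_def tame_def)
    then show ?case
      using partial_cong(2)[OF V Cons.prems, of "\<lambda>z. iter_partial vs f z + iter_partial vs g z" _ v] Cons.IH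
      by (simp add: partial_add(2))
  qed simp
  show ?thesis
    unfolding all_tame_def
    by (intro allI tame_cong[OF V eq] tame_add) (use f g in \<open>auto simp: all_tame_def\<close>)
qed

lemma all_tame_cmult:
  assumes V: "open V" and f: "all_tame V f"
  shows "all_tame V (\<lambda>z. c * f z)"
proof -
  have eq: "c * iter_partial vs f z = iter_partial vs (\<lambda>z. c * f z) z" if "z \<in> V" for vs z
    using that
  proof (induction vs arbitrary: z)
    case (Cons v vs)
    have "has_partial v (iter_partial vs f) z"
      using f Cons.prems by (auto simp: all_tame_def tame_def)
    then show ?case
      using partial_cong(2)[OF V Cons.prems, of "\<lambda>z. c * iter_partial vs f z" _ v] Cons.IH
      by (simp add: partial_cmult(2))
  qed simp
  show ?thesis
    unfolding all_tame_def
    by (intro allI tame_cong[OF V eq] tame_cmult) (use f in \<open>auto simp: all_tame_def\<close>)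
qed

lemma all_tame_sum:
  assumes V: "open V" and "finite I" "I \<noteq> {}" "\<And>i. i \<in> I \<Longrightarrow> all_tame V (f i)"
  shows "all_tame V (\<lambda>z. \<Sum>i\<in>I. f i z)"
  using assms(2-4) by (induction rule: finite_ne_induct) (auto intro: all_tame_add[OF V])

text \<open>The first differentiation is the last list entry, so a derivative taken beforehand is
  appended at the end.\<close>

lemma all_tame_partial: "all_tame V f \<Longrightarrow> all_tame V (partial v f)"
proof -
  have "iter_partial vs (partial v f) = iter_partial (vs @ [v]) f" for vs
    by (simp add: iter_partial_def)
  then show "all_tame V f \<Longrightarrow> all_tame V (partial v f)"
    unfolding all_tame_def by simp
qed

lemma all_tame_d_op:
  assumes V: "open V" and f: "all_tame V f"
  shows "all_tame V (d_op j f)" "all_tame V (dbar_op j f)"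
proof -
  have *: "all_tame V (\<lambda>z. (1 / 2) * partial (X_var j) f z + c * partial (Y_var j) f z)" for c
    by (intro all_tame_add all_tame_cmult all_tame_partial V f)
  have eq: "d_op j f = (\<lambda>z. (1 / 2) * partial (X_var j) f z + (- \<i> / 2) * partial (Y_var j) f z)"
    "dbar_op j f = (\<lambda>z. (1 / 2) * partial (X_var j) f z + (\<i> / 2) * partial (Y_var j) f z)"
    by (simp_all add: d_op_def dbar_op_def fun_eq_iff field_simps)
  show "all_tame V (d_op j f)" "all_tame V (dbar_op j f)"
    unfolding eq by (rule *)+
qed

section \<open>Membership in the function spaces\<close>

lemma multi_op_preserves:
  assumes D: "\<And>j f. P f \<Longrightarrow> P (D j f)" and f: "P f"
  shows "P (multi_op D \<alpha> f)"
proof -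
  have pow: "P ((D j ^^ n) f)" if "P f" for j n f
    using that by (induction n) (auto intro: D)
  have "P (foldr (\<lambda>j. D j ^^ \<alpha> j) js f)" for js
    by (induction js) (auto intro: pow f)
  then show ?thesis by (simp add: multi_op_def)
qed

text \<open>Parallelogram law for a - \<i> b and a + \<i> b, divided by 4.\<close>

lemma d_op_dbar_op_norm:
  "(cmod (d_op j f z))\<^sup>2 + (cmod (dbar_op j f z))\<^sup>2 =
    ((cmod (partial (X_var j) f z))\<^sup>2 + (cmod (partial (Y_var j) f z))\<^sup>2) / 2"
  by (simp add: d_op_def dbar_op_def cmod_power2 norm_divide power_divide) (simp add: field_simps power2_eq_square)

lemma all_tame_C_k:
  assumes "all_tame V f"
  shows "f \<in> C_k k V"
  using assms by (auto simp: C_k_def all_tame_def tame_def)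

lemma all_tame_C1_F:
  assumes f: "all_tame V f"
  shows "f \<in> C1_F V"
  unfolding C1_F_def
proof (intro CollectI conjI allI impI)
  show "f \<in> C_k 1 V" by (rule all_tame_C_k[OF f])
  fix S assume S: "uniformly_included S V"
  have "tame V f"
    using f unfolding all_tame_def by (metis iter_partial_Nil)
  then obtain K where K: "0 \<le> K" "\<And>z. z \<in> S \<Longrightarrow> cmod (f z) \<le> K"
    "\<And>z A. z \<in> S \<Longrightarrow> finite A \<Longrightarrow> (\<Sum>v\<in>A. (cmod (partial v f z))\<^sup>2) \<le> K"
    using S by (rule tameE) blast
  have "ennreal (cmod (f z)) + (\<Sum>j. ennreal ((cmod (d_op j f z))\<^sup>2 + (cmod (dbar_op j f z))\<^sup>2))
      \<le> ennreal K + ennreal K" if z: "z \<in> S" for z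
  proof (rule add_mono)
    show "ennreal (cmod (f z)) \<le> ennreal K"
      using K z by (simp add: ennreal_leI)
    \<comment> \<open>A partial sum over \<open>j < n\<close> is half a gradient sum over the 2 n
      real variables with index below \<open>n\<close>, which form a finite set as in the definition
      of \<open>tame\<close>.\<close>
    have "(\<Sum>j<n. ennreal ((cmod (d_op j f z))\<^sup>2 + (cmod (dbar_op j f z))\<^sup>2)) \<le> ennreal K" for n
    proof -
      have inj: "inj_on X_var {..<n}" "inj_on Y_var {..<n}"
        by (auto simp: inj_on_def)
      have "(\<Sum>j<n. (cmod (d_op j f z))\<^sup>2 + (cmod (dbar_op j f z))\<^sup>2)
          = (\<Sum>v\<in>X_var ` {..<n} \<union> Y_var ` {..<n}. (cmod (partial v f z))\<^sup>2) / 2"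
        unfolding d_op_dbar_op_norm sum_divide_distrib[symmetric] sum.distrib
        by (subst sum.union_disjoint) (auto simp: sum.reindex inj)
      also have "\<dots> \<le> K"
        using K(1) K(3)[OF z, of "X_var ` {..<n} \<union> Y_var ` {..<n}"] by simp
      finally show ?thesis
        by (subst sum_ennreal) (auto intro: ennreal_leI)
    qed
    then show "(\<Sum>j. ennreal ((cmod (d_op j f z))\<^sup>2 + (cmod (dbar_op j f z))\<^sup>2)) \<le> ennreal K"
      by (simp add: suminf_eq_SUP SUP_le_iff)
  qed
  then have "(SUP z\<in>S. ennreal (cmod (f z)) +
      (\<Sum>j. ennreal ((cmod (d_op j f z))\<^sup>2 + (cmod (dbar_op j f z))\<^sup>2))) \<le> ennreal K + ennreal K"
    by (rule SUP_least)
  also have "\<dots> < \<infinity>" by simp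
  finally show "(SUP z\<in>S. ennreal (cmod (f z)) +
      (\<Sum>j. ennreal ((cmod (d_op j f z))\<^sup>2 + (cmod (dbar_op j f z))\<^sup>2))) < \<infinity>" .
qed

lemma all_tame_C_infinity_F:
  assumes V: "open V" and f: "all_tame V f"
  shows "f \<in> C_infinity_F V"
  unfolding C_infinity_F_def C_infinity_def
  using all_tame_C_k[OF f]
  by (auto intro!: all_tame_C1_F multi_op_preserves[where P = "all_tame V"] all_tame_d_op V f)

section \<open>Tameness from local data\<close>

lemma uniformly_included_singleton:
  assumes "open V" "z \<in> V"
  shows "uniformly_included {z} V"
proof (cases "V = UNIV")
  case False
  then have "frontier V \<noteq> {}"
    using assms(2) connected_UNIV frontier_eq_empty by blast
  moreover have "z \<notin> frontier V"
    using assms frontier_disjoint_eq by blast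
  ultimately have "0 < setdist {z} (frontier V)"
    by (simp add: infdist_eq_setdist[symmetric] infdist_pos_not_in_closed)
  with False assms show ?thesis
    by (simp add: uniformly_included_def bdry_dist_def)
qed (simp add: uniformly_included_UNIV)

text \<open>Agreement on an open set passes to all iterated derivatives. Singletons are uniformly
  included, which gives continuity and differentiability at each point. Uniformly included sets are
  bounded, hence uniformly included in the whole space, where \<open>h\<close> has its
  bounds.\<close>

lemma all_tame_locally:
  assumes V: "open V"
    and loc: "\<And>S. uniformly_included S V \<Longrightarrow>
      \<exists>W h. open W \<and> S \<subseteq> W \<and> all_tame UNIV h \<and> (\<forall>z\<in>W. f z = h z)"
  shows "all_tame V f"
  unfolding all_tame_def tame_def
proof (intro conjI allI ballI impI)
  fix vs
  have loc': "\<exists>W h. open W \<and> S \<subseteq> W \<and> tame UNIV h \<and> (\<forall>z\<in>W. iter_partial vs f z = h z)"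
    if S: "uniformly_included S V" for S
  proof -
    obtain W h where "open W" "S \<subseteq> W" "all_tame UNIV h" "\<forall>z\<in>W. f z = h z"
      using loc[OF S] by blast
    then show ?thesis
      using iter_partial_cong[of W f h] unfolding all_tame_def by (intro exI[of _ W] exI[of _ "iter_partial vs h"]) auto
  qed
  have "isCont (iter_partial vs f) z \<and> (\<forall>v. has_partial v (iter_partial vs f) z)" if z: "z \<in> V" for z
  proof -
    obtain W h where W: "open W" "z \<in> W" and h: "tame UNIV h" "\<forall>z\<in>W. iter_partial vs f z = h z"
      using loc'[OF uniformly_included_singleton[OF V z]] by blast
    have "isCont h z" "has_partial v h z" for v
      using h(1) by (auto simp: tame_def continuous_on_eq_continuous_at)
    moreover have "\<forall>\<^sub>F w in nhds z. iter_partial vs f w = h w"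
      using W h(2) eventually_nhds by blast
    ultimately show ?thesis
      using partial_cong(1)[of W z "iter_partial vs f" h] W h(2) isCont_cong by blast
  qed
  then show "continuous_on V (iter_partial vs f)" "\<And>z v. z \<in> V \<Longrightarrow> has_partial v (iter_partial vs f) z"
    using V by (auto simp: continuous_on_eq_continuous_at)
  fix S assume S: "uniformly_included S V"
  obtain W h where W: "open W" "S \<subseteq> W" and h: "tame UNIV h" "\<And>z. z \<in> W \<Longrightarrow> iter_partial vs f z = h z"
    using loc'[OF S] by blast
  obtain K where "\<And>z. z \<in> S \<Longrightarrow> cmod (h z) \<le> K"
    "\<And>z A. z \<in> S \<Longrightarrow> finite A \<Longrightarrow> (\<Sum>v\<in>A. (cmod (partial v h z))\<^sup>2) \<le> K"
    using h(1) uniformly_included_UNIV[OF uniformly_included_bounded[OF S]] by (rule tameE) blast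
  moreover have "iter_partial vs f z = h z" "partial v (iter_partial vs f) z = partial v h z" if "z \<in> S" for z v
    using that W h(2) partial_cong(2)[OF W(1) _ h(2)] by auto
  ultimately show "\<exists>K. \<forall>z\<in>S. cmod (iter_partial vs f z) \<le> K \<and>
      (\<forall>A. finite A \<longrightarrow> (\<Sum>v\<in>A. (cmod (partial v (iter_partial vs f) z))\<^sup>2) \<le> K)"
    by (intro exI[of _ K]) simp
qed

section \<open>Smooth exhaustion functions\<close>

context mollifier
begin

text \<open>Every iterated partial derivative is again \<open>mollify F f\<close> for some finite
  \<open>F\<close>. It is bounded and Lipschitz with continuous partial derivatives, so its gradient
  is bounded by its Lipschitz constant.\<close>

lemma all_tame_mollify:
  assumes f: "L-lipschitz_on UNIV f" and K: "\<And>z. \<bar>f z\<bar> \<le> K"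
  shows "all_tame UNIV (\<lambda>z. complex_of_real (mollify {} f z))"
proof -
  \<comment> \<open>A fresh position for differentiation along \<open>v\<close>; it exists because
    \<open>F\<close> is finite and \<open>v\<close> occurs infinitely often.\<close>
  define next_index where "next_index F v = (SOME k. k \<notin> F \<and> axis k = v)" for F v
  have next_index: "next_index F v \<notin> F \<and> axis (next_index F v) = v" if "finite F" for F v
  proof -
    have "\<exists>k. k \<notin> F \<and> axis k = v"
      using infinitely_often[of v] finite_subset[OF _ that, of "{n. axis n = v}"] by auto
    then show ?thesis
      unfolding next_index_def by (rule someI_ex)
  qed
  have deriv: "((\<lambda>\<tau>. mollify F f (z + \<tau> *\<^sub>R direction v)) has_real_derivative
      mollify (insert (next_index F v) F) f z) (at 0)" if "finite F" for F v z
    using mollify_derivative[OF that f K, of "next_index F v"] next_index[OF that, of v] by simp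
  have cpartial: "((\<lambda>\<tau>. complex_of_real (mollify F f (z + \<tau> *\<^sub>R direction v))) has_vector_derivative
      complex_of_real (mollify (insert (next_index F v) F) f z)) (at 0)" if "finite F" for F v z
    using deriv[OF that]
    by (intro has_vector_derivative_of_real) (simp add: has_real_derivative_iff_has_vector_derivative)
  note partial = partialI[OF cpartial]
  have tame: "tame UNIV (\<lambda>z. complex_of_real (mollify F f z))" if F: "finite F" for F
    unfolding tame_def
  proof (intro conjI allI ballI impI)
    have cont: "continuous_on UNIV (mollify F f)" if "finite F" for F
      by (rule lipschitz_on_continuous_on[OF mollify_lipschitz[OF that f K]])
    show "continuous_on UNIV (\<lambda>z. complex_of_real (mollify F f z))"
      by (intro continuous_intros cont F)
    show "has_partial v (\<lambda>z. complex_of_real (mollify F f z)) z" for v z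
      by (rule partial(1)[OF F])
    have "(\<Sum>v\<in>A. (mollify (insert (next_index F v) F) f z)\<^sup>2) \<le> (gain F * L)\<^sup>2" if "finite A" for A z
      by (rule lipschitz_gradient_bound[OF mollify_lipschitz[OF F f K] deriv[OF F] cont that])
        (use F in auto)
    then have "\<forall>z\<in>S. cmod (complex_of_real (mollify F f z)) \<le> max (gain F * K) ((gain F * L)\<^sup>2) \<and>
        (\<forall>A. finite A \<longrightarrow> (\<Sum>v\<in>A. (cmod (partial v (\<lambda>z. complex_of_real (mollify F f z)) z))\<^sup>2)
          \<le> max (gain F * K) ((gain F * L)\<^sup>2))" for S
      using mollify_bounded[OF F f K] by (auto simp: partial(2)[OF F] le_max_iff_disj)
    then show "\<exists>K. \<forall>z\<in>S. cmod (complex_of_real (mollify F f z)) \<le> K \<and>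
        (\<forall>A. finite A \<longrightarrow> (\<Sum>v\<in>A. (cmod (partial v (\<lambda>z. complex_of_real (mollify F f z)) z))\<^sup>2) \<le> K)" for S
      by blast
  qed
  have "\<exists>F. finite F \<and> iter_partial vs (\<lambda>z. complex_of_real (mollify {} f z)) = (\<lambda>z. complex_of_real (mollify F f z))" for vs
  proof (induction vs)
    case Nil
    then show ?case by (auto intro: exI[of _ "{}"])
  next
    case (Cons v vs)
    then obtain F where F: "finite F" "iter_partial vs (\<lambda>z. complex_of_real (mollify {} f z)) = (\<lambda>z. complex_of_real (mollify F f z))"
      by blast
    have "partial v (\<lambda>z. complex_of_real (mollify F f z)) = (\<lambda>z. complex_of_real (mollify (insert (next_index F v) F) f z))"
      by (rule ext) (rule partial(2)[OF F(1)])
    then show ?case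
      using F by (intro exI[of _ "insert (next_index F v) F"]) simp
  qed
  then show ?thesis
    unfolding all_tame_def using tame by metis
qed

end

text \<open>The radii add up to \<epsilon>, which therefore bounds both the reach of the smoothing
  and, after multiplication by \<open>L\<close>, its error.\<close>

lemma smooth_approximation:
  fixes f :: "ell2 \<Rightarrow> real"
  assumes f: "L-lipschitz_on UNIV f" and f01: "\<And>z. f z \<in> {0..1}" and \<epsilon>: "0 < \<epsilon>"
  obtains g where "all_tame UNIV (\<lambda>z. complex_of_real (g z))" "\<And>z. 0 \<le> g z"
    "\<And>z. \<bar>g z - f z\<bar> \<le> L * \<epsilon>"
    "\<And>z. (\<And>w. norm (w - z) \<le> \<epsilon> \<Longrightarrow> f w = 0) \<Longrightarrow> g z = 0"
proof -
  define r :: "nat \<Rightarrow> real" where "r n = \<epsilon> * (1 / 2) ^ Suc n" for n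
  \<comment> \<open>The first component of the decoded pair selects the variable; the second runs
    freely, so every variable recurs infinitely often.\<close>
  define axis :: "nat \<Rightarrow> real_var" where "axis n = from_nat (fst (prod_decode n))" for n
  have r: "r sums \<epsilon>"
    unfolding r_def using sums_mult[OF power_half_series, of \<epsilon>] by simp
  interpret mollifier r axis
  proof
    show "0 < r n" for n using \<epsilon> by (simp add: r_def)
    show "summable r" using r by (rule sums_summable)
    have "range (\<lambda>i. prod_encode (to_nat v, i)) \<subseteq> {n. axis n = v}" for v
      by (auto simp: axis_def)
    moreover have "infinite (range (\<lambda>i. prod_encode (to_nat v, i)))" for v :: real_var
      by (rule range_inj_infinite) (simp add: inj_def)
    ultimately show "infinite {n. axis n = v}" for v
      using finite_subset by blast
  qed
  have K: "\<bar>f z\<bar> \<le> 1" for z using f01[of z] by auto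
  show ?thesis
  proof (rule that[of "mollify {} f"])
    show "all_tame UNIV (\<lambda>z. complex_of_real (mollify {} f z))"
      by (rule all_tame_mollify[OF f K])
    show "0 \<le> mollify {} f z" for z
      by (rule mollify_nonneg[OF f K]) (use f01 in auto)
    show "\<bar>mollify {} f z - f z\<bar> \<le> L * \<epsilon>" for z
      using mollify_close[OF f K, of z] by (simp add: sums_unique[OF r, symmetric])
    show "mollify {} f z = 0" if "\<And>w. norm (w - z) \<le> \<epsilon> \<Longrightarrow> f w = 0" for z
      by (rule mollify_eq_0[OF _ f K]) (use that in \<open>auto simp: sums_unique[OF r, symmetric]\<close>)
  qed
qed

section \<open>Construction of the exhaustion function\<close>

theorem theorem3p2:
  fixes V :: "ell2 set"
  assumes "open V" and "V \<noteq> {}"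
  shows "\<exists>\<eta> :: ell2 \<Rightarrow> real. exhaustion_function V \<eta> \<and> (\<lambda>z. complex_of_real (\<eta> z)) \<in> C_infinity_F V"
proof -
  \<comment> \<open>The whole space has empty frontier, for which \<open>infdist\<close> has the
    value 0; the constant 1 replaces it. Otherwise \<rho> is the distance to the frontier also
    outside \<open>V\<close>, so that it is Lipschitz on all of \<open>ell2\<close>.\<close>
  define \<rho> where "\<rho> z = (if V = UNIV then 1 else infdist z (frontier V))" for z :: ell2
  have frontier: "frontier V \<noteq> {}" if "V \<noteq> UNIV"
    using that assms(2) connected_UNIV frontier_eq_empty by blast
  have \<rho>_lip: "\<bar>\<rho> z - \<rho> w\<bar> \<le> norm (z - w)" for z w
    using infdist_triangle_abs[of z "frontier V" w] by (simp add: \<rho>_def dist_norm)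
  have \<rho>_cont: "continuous_on UNIV \<rho>"
    unfolding \<rho>_def by (cases "V = UNIV") (auto intro!: continuous_intros)
  have n\<rho>_lip: "\<bar>real n * \<rho> z - real n * \<rho> w\<bar> \<le> real n * norm (z - w)" for n z w
    using mult_left_mono[OF \<rho>_lip[of z w], of "real n"]
    by (simp add: right_diff_distrib[symmetric] abs_mult)
  \<comment> \<open>\<open>f n\<close> equals 1 as soon as norm z \<ge> n + 1 or n * \<rho> z \<le>
    1.\<close>
  define f where "f n z = min 1 (max 0 (norm z - real n) + max 0 (2 - real n * \<rho> z))" for n z
  have f_lip: "(real n + 1)-lipschitz_on UNIV (f n)" for n
  proof (rule lipschitz_onI)
    fix z w :: ell2
    have "\<bar>f n z - f n w\<bar> \<le> \<bar>norm z - norm w\<bar> + \<bar>real n * \<rho> z - real n * \<rho> w\<bar>"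
      unfolding f_def by (auto simp: min_def max_def)
    then show "dist (f n z) (f n w) \<le> (real n + 1) * dist z w"
      using n\<rho>_lip[of n z w] norm_triangle_ineq3[of z w]
      by (simp add: dist_norm distrib_right)
  qed simp
  \<comment> \<open>The radius 1 / (2 (n + 1)) is matched to the Lipschitz constant n + 1, so that
    the smoothing error is at most 1 / 2.\<close>
  have "\<exists>h. all_tame UNIV (\<lambda>z. complex_of_real (h z)) \<and> (\<forall>z. 0 \<le> h z) \<and> (\<forall>z. \<bar>h z - f n z\<bar> \<le> 1 / 2) \<and>
      (\<forall>z. (\<forall>w. norm (w - z) \<le> 1 / (2 * (real n + 1)) \<longrightarrow> f n w = 0) \<longrightarrow> h z = 0)" for n
  proof -
    have "f n z \<in> {0..1}" for z by (auto simp: f_def)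
    moreover have "0 < 1 / (2 * (real n + 1))" by simp
    ultimately obtain h where "all_tame UNIV (\<lambda>z. complex_of_real (h z))" "\<And>z. 0 \<le> h z"
      "\<And>z. \<bar>h z - f n z\<bar> \<le> (real n + 1) * (1 / (2 * (real n + 1)))"
      "\<And>z. (\<And>w. norm (w - z) \<le> 1 / (2 * (real n + 1)) \<Longrightarrow> f n w = 0) \<Longrightarrow> h z = 0"
      using smooth_approximation[OF f_lip[of n]] by blast
    moreover have "(real n + 1) * (1 / (2 * (real n + 1))) = 1 / 2"
      by (simp add: field_simps)
    ultimately show ?thesis by metis
  qed
  then obtain g where g: "\<And>n. all_tame UNIV (\<lambda>z. complex_of_real (g n z))"
    and g_nonneg: "\<And>n z. 0 \<le> g n z"
    and g_close: "\<And>n z. \<bar>g n z - f n z\<bar> \<le> 1 / 2"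
    and g_zero: "\<And>n z. (\<And>w. norm (w - z) \<le> 1 / (2 * (real n + 1)) \<Longrightarrow> f n w = 0) \<Longrightarrow> g n z = 0"
    by metis
  \<comment> \<open>The constant 3 instead of 2 leaves room for smoothing: within the radius,
    \<open>n * \<rho>\<close> drops by at most 1.\<close>
  define W where "W m = {z. norm z < real m \<and> 3 < real m * \<rho> z}" for m
  have W_open: "open (W m)" for m
  proof -
    have "W m = {z. norm z < real m} \<inter> {z. 3 < real m * \<rho> z}"
      by (auto simp: W_def)
    then show ?thesis
      by (auto intro!: open_Int open_Collect_less continuous_intros \<rho>_cont)
  qed
  \<comment> \<open>From n \<ge> m + 1 on, the ball seen by the smoothing has norms at most m + 1
    \<le> n, and \<open>n * \<rho>\<close> is at least 2 on it, so \<open>f n\<close> vanishes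
    there.\<close>
  have g_W: "g n z = 0" if z: "z \<in> W m" and n: "n \<notin> {..<Suc m}" for m n z
  proof (rule g_zero)
    fix w assume w: "norm (w - z) \<le> 1 / (2 * (real n + 1))"
    have "0 \<le> \<rho> z" by (simp add: \<rho>_def infdist_nonneg)
    then have "real m * \<rho> z \<le> real n * \<rho> z"
      using n by (intro mult_right_mono) auto
    then have "3 \<le> real n * \<rho> z"
      using z by (simp add: W_def)
    moreover have "real n * norm (w - z) \<le> real n * (1 / (2 * (real n + 1)))"
      by (rule mult_left_mono[OF w]) simp
    moreover have "real n * (1 / (2 * (real n + 1))) \<le> 1"
      by (simp add: field_simps)
    ultimately have 1: "2 \<le> real n * \<rho> w"
      using n\<rho>_lip[of n w z] by linarith
    have "1 / (2 * (real n + 1)) \<le> 1"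
      by (simp add: field_simps)
    then have "norm w \<le> norm z + 1"
      using w norm_triangle_ineq2[of w z] by linarith
    moreover have "norm z < real m" "real m + 1 \<le> real n"
      using z n by (auto simp: W_def)
    ultimately show "f n w = 0"
      using 1 by (simp add: f_def)
  qed
  have W_cover: "\<exists>m. S \<subseteq> W m" if S: "uniformly_included S V" for S
  proof (cases "S = {}")
    case False
    obtain B where B: "\<And>z. z \<in> S \<Longrightarrow> norm z \<le> B"
      using uniformly_included_bounded[OF S] by (auto simp: bounded_iff)
    obtain \<delta> where \<delta>: "0 < \<delta>" "\<And>z. z \<in> S \<Longrightarrow> \<delta> \<le> \<rho> z"
    proof (cases "V = UNIV")
      case True
      then show ?thesis by (intro that[of 1]) (auto simp: \<rho>_def)
    next
      case nU: False
      show ?thesis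
      proof (rule that)
        show "0 < setdist S (frontier V)"
          using S False nU by (simp add: uniformly_included_def bdry_dist_def)
        show "setdist S (frontier V) \<le> \<rho> z" if "z \<in> S" for z
          using setdist_subset_left[of "{z}" S "frontier V"] that nU
          by (simp add: \<rho>_def infdist_eq_setdist)
      qed
    qed
    \<comment> \<open>The two entries give norm z < m and 3 < m * \<delta> on
      \<open>S\<close>.\<close>
    obtain m where m: "real m > max B (3 / \<delta>)"
      using reals_Archimedean2 by blast
    have "z \<in> W m" if z: "z \<in> S" for z
    proof -
      have "3 < real m * \<delta>"
        using m \<delta>(1) by (simp add: pos_divide_less_eq)
      also have "\<dots> \<le> real m * \<rho> z"
        using \<delta>(2)[OF z] by (intro mult_left_mono) auto
      finally show ?thesis
        using B[OF z] m by (auto simp: W_def)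
    qed
    then show ?thesis by blast
  qed auto
  define \<eta> where "\<eta> z = (\<Sum>n. g n z)" for z
  have \<eta>_W: "\<eta> z = (\<Sum>n<Suc m. g n z)" if "z \<in> W m" for m z
    unfolding \<eta>_def by (rule suminf_finite) (use g_W[OF that] in auto)
  have "all_tame V (\<lambda>z. complex_of_real (\<eta> z))"
  proof (rule all_tame_locally[OF assms(1)])
    fix S assume "uniformly_included S V"
    then obtain m where "S \<subseteq> W m" using W_cover by blast
    moreover have "all_tame UNIV (\<lambda>z. \<Sum>n<Suc m. complex_of_real (g n z))"
      by (intro all_tame_sum g) auto
    moreover have "\<forall>z\<in>W m. complex_of_real (\<eta> z) = (\<Sum>n<Suc m. complex_of_real (g n z))"
      by (auto simp: \<eta>_W)
    ultimately show "\<exists>W h. open W \<and> S \<subseteq> W \<and> all_tame UNIV h \<and> (\<forall>z\<in>W. complex_of_real (\<eta> z) = h z)"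
      using W_open by blast
  qed
  then have "(\<lambda>z. complex_of_real (\<eta> z)) \<in> C_infinity_F V"
    by (rule all_tame_C_infinity_F[OF assms(1)])
  moreover have "exhaustion_function V \<eta>"
    unfolding exhaustion_function_def
  proof
    fix t
    define T where "T = {z \<in> V. \<eta> z \<le> t}"
    \<comment> \<open>At a point with norm z \<ge> m + 1 or m * \<rho> z \<le> 1, all m + 1 cut-offs
      with n \<le> m equal 1, so their smoothings are at least 1 / 2 and \<eta> z \<ge> (m + 1) / 2
      > t. The entry 1 makes \<open>m\<close> positive for the later division.\<close>
    obtain m where m: "real m > max 1 (2 * t)"
      using reals_Archimedean2 by blast
    have T: "norm z < real m + 1 \<and> 1 < real m * \<rho> z" if z: "z \<in> T" for z
    proof (rule ccontr)
      assume far: "\<not> ?thesis"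
      have "1 / 2 \<le> g n z" if n: "n < Suc m" for n
      proof -
        have "real n * \<rho> z \<le> real m * \<rho> z"
          using n by (intro mult_right_mono) (auto simp: \<rho>_def infdist_nonneg)
        then have "f n z = 1"
          using far n by (auto simp: f_def)
        then show ?thesis
          using g_close[of n z] by linarith
      qed
      then have "(\<Sum>n<Suc m. 1 / 2) \<le> (\<Sum>n<Suc m. g n z)"
        by (intro sum_mono) auto
      \<comment> \<open>Some \<open>W M\<close> contains \<open>z\<close>, which makes the series a
        finite sum; its partial sums are then bounded by \<eta> z.\<close>
      also obtain M where "z \<in> W M"
        using W_cover[OF uniformly_included_singleton[OF assms(1), of z]] z by (auto simp: T_def)
      then have "summable (\<lambda>n. g n z)"
        by (intro summable_finite[of "{..<Suc M}"] g_W) auto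
      then have "(\<Sum>n<Suc m. g n z) \<le> \<eta> z"
        unfolding \<eta>_def by (intro sum_le_suminf g_nonneg) auto
      also have "\<eta> z \<le> t" using z by (simp add: T_def)
      finally show False using m by simp
    qed
    have "T \<noteq> {} \<Longrightarrow> 0 < bdry_dist T V"
    proof (cases "V = UNIV")
      case False
      assume "T \<noteq> {}"
      \<comment> \<open>On \<open>T\<close> the bound 1 < m * \<rho> z keeps all points at distance
        at least 1 / m from the frontier.\<close>
      have "1 / real m \<le> setdist T (frontier V)"
      proof (rule le_setdistI)
        fix x y assume x: "x \<in> T" and y: "y \<in> frontier V"
        have "1 / real m \<le> \<rho> x"
          using T[OF x] m by (simp add: pos_divide_le_eq mult.commute)
        also have "\<dots> \<le> dist x y"
          using False y by (simp add: \<rho>_def infdist_le)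
        finally show "1 / real m \<le> dist x y" .
      qed (use \<open>T \<noteq> {}\<close> frontier[OF False] in auto)
      moreover have "0 < 1 / real m" using m by simp
      ultimately have "0 < setdist T (frontier V)" by linarith
      then show ?thesis using False by (simp add: bdry_dist_def)
    qed (simp add: bdry_dist_def)
    moreover have "bounded T"
      unfolding bounded_iff using T by (intro exI[of _ "real m + 1"]) (auto intro: less_imp_le)
    moreover have "T \<subseteq> V" by (auto simp: T_def)
    ultimately show "uniformly_included {z \<in> V. \<eta> z \<le> t} V"
      unfolding uniformly_included_def T_def by blast
  qed
  ultimately show ?thesis by blast
qed

end
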